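(* Let $p_1,p_2\in\mathbb{R}_{\max}^n$, $q_1,q_2\in(\mathbb{R}\cup\{+\infty\})^n$, $U,V\in\mathbb{R}_{\max}^{m\times n}$, $b,d\in\mathbb{R}_{\max}^m$, and let $A$ and $B(\lambda_1,\lambda_2)$ be the matrices defined in the context. Suppose that each row of $U,V$ has at least one finite entry, each of $p_1,p_2$ has at least one finite entry, and each of $q_1,q_2$ has at least one finite entry. Then: (i) For each fixed $(\lambda_1,\lambda_2)\in\mathbb{R}^2$, the mean-payoff game defined by $A$ and $B(\lambda_1,\lambda_2)$ has a uniquely determined value vector $\chi(\overline{A}B(\lambda_1,\lambda_2))\in\mathbb{R}^{n+1}$, whose $j$-th component $\chi_j=\chi_j(\overline{A}B(\lambda_1,\lambda_2))$ gives the long-run average payoff per turn when the game starts from Min node $v_j$. Moreover, there exist optimal positional strategies $\sigma^*\in\mathcal{S}$ and $\tau^*\in\mathcal{T}$ such that $\sigma^*$ secures Max a mean profit of at least $\chi_j$ from any starting node $v_j$, regardless of Min's strategy, and $\tau^*$ secures a mean loss of no more than $\chi_j$ from any starting node $v_j$, regardless of Max's strategy. (ii) The value satisfies the duality $$\max_{\sigma\in\mathcal{S}}\chi(f^\sigma(\lambda_1,\lambda_2))=\chi(\overline{A}B(\lambda_1,\lambda_2))=\min_{\tau\in\mathcal{T}}\chi(f^\tau(\lambda_1,\lambda_2)).$$ (iii) For each strategy $\sigma$ of Max, fixing $\sigma$ reduces the two-player game to a min-plus one-player game $G^\sigma$ in which Min controls all moves. Since Min seeks to minimize Max's payoff, the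 cycle-time $\chi_j(f^\sigma(\lambda_1,\lambda_2))$ is the minimal (not maximal) cycle mean over all cycles in $G^\sigma$ accessible from $j$, because it is Min who optimizes against the fixed $\sigma$. Since each node in $G^\sigma$ has exactly one outgoing arc (determined by $\sigma$), every node eventually leads to exactly one cycle in $G^\sigma$, and the minimum is taken over all such cycles reachable from $j$. Explicitly, $$\chi_j(f^\sigma(\lambda_1,\lambda_2))=\min_{\substack{\text{cycles }\gamma\text{ in }G^\sigma\\ \text{accessible from }j}}\frac{k_1(\gamma)\lambda_1+k_2(\gamma)\lambda_2+s(\gamma)}{|\gamma|}.$$ Since $k_1(\gamma),k_2(\gamma)\ge 0$ for each elementary cycle in $G^\sigma$, each cycle mean $(k_1(\gamma)\lambda_1+k_2(\gamma)\lambda_2+s(\gamma))/|\gamma|$ is linear in $(\lambda_1,\lambda_2)$. Consequently, $(\lambda_1,\lambda_2)\mapsto\chi_j(f^\sigma(\lambda_1,\lambda_2))$ is a minimum of finitely many linear functions of $(\lambda_1,\lambda_2)$, hence piecewise linear, continuous, and componentwise non-decreasing. (iv) The feasibility condition $(\lambda_1,\lambda_2)\in\mathcal{R}$ holds if and only if all components of the cycle-time vector $\chi(\overline{A}B(\lambda_1,\lambda_2))$ are non-negative, i.e. $\chi_j(\overline{A}B(\lambda_1,\lambda_2))\ge 0$ for all $j\in[n+1]$.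
   Context: Notation: $\mathbb{R}_{\max}=\mathbb{R}\cup\{-\infty\}$, $a\oplus c=\max(a,c)$, $a\otimes c=a+c$, extended to matrices and vectors as usual; $[N]=\{1,\dots,N\}$. For a vector $x$, $x^-$ is the row vector with entries $-x_j$ (with $-(+\infty)=-\infty$, $-(-\infty)=+\infty$); for a matrix $A=(a_{ij})$, $\overline{A}$ is the matrix with $(\overline{A})_{ij}=-a_{ji}$ (same convention). Problem: $f_k(x)=x^-\otimes p_k\oplus q_k^-\otimes x=\max\big(\max_j(p_{kj}-x_j),\max_j(x_j-q_{kj})\big)$, $k=1,2$, and a finite $x\in\mathbb{R}^n$ is feasible if $U\otimes x\oplus b\le V\otimes x\oplus d$. The feasibility region is $$\mathcal{R}=\{(\lambda_1,\lambda_2)\in\mathbb{R}^2:\exists\,x\in\mathbb{R}^n\text{ finite, feasible, with }f_1(x)\le\lambda_1\text{ and }f_2(x)\le\lambda_2\}.$$ Matrices, of size $(m+2n+2)\times(n+1)$, with row groups $C_1,\dots,C_5$ of sizes $m,n,1,n,1$ and column groups of sizes $n,1$ (blocks "$-\infty$" are filled with $-\infty$; $\lambda I$ has $\lambda$ on the diagonal and $-\infty$ elsewhere): $$A=\begin{pmatrix} U & b\\ -\infty & p_1\\ q_1^- & -\infty\\ -\infty & p_2\\ q_2^- & -\infty\end{pmatrix},\qquad B(\lambda_1,\lambda_2)=\begin{pmatrix} V & d\\ \lambda_1 I & -\infty\\ -\infty & \lambda_1\\ \lambda_2 I & -\infty\\ -\infty & \lambda_2\end{pmatrix}.$$ Mean-payoff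 game of $A=(a_{ij})$, $B=(b_{ij})$: played on a bipartite digraph whose Max nodes are the rows and whose Min nodes $v_j$ are the columns. At a Max node $k$, Max chooses an arc to a Min node $l$ with $b_{kl}\ne-\infty$ and receives $b_{kl}$; at a Min node $j$, Min chooses an arc to a Max node $i$ with $a_{ij}\ne-\infty$ and pays $-a_{ij}$ to Max. Max maximizes and Min minimizes the long-run average payment per turn. A positional strategy of Max is a map $\sigma$ from rows to columns with $b_{i\sigma(i)}\ne-\infty$ for all $i$; one of Min is a map $\tau$ from columns to rows with $a_{\tau(j)j}\ne-\infty$ for all $j$. $\mathcal{S}$ and $\mathcal{T}$ are the sets of positional strategies of Max and Min. Functions and cycle-time vectors, with $B=B(\lambda_1,\lambda_2)$: the min-max function $f_j(x)=\min_{i}\big(-a_{ij}+\max_{l}(b_{il}+x_l)\big)$, i.e. $x\mapsto\overline{A}\otimes(B\otimes x)$ with the outer product taken in the min-plus sense; for a strategy $\sigma$ of Max, $f^\sigma_j(x)=\min_{i}(-a_{ij}+b_{i\sigma(i)}+x_{\sigma(i)})$; for a strategy $\tau$ of Min, $f^\tau_j(x)=-a_{\tau(j)j}+\max_l(b_{\tau(j)l}+x_l)$; here $j,l\in[n+1]$ and $i\in[m+2n+2]$. For such a function $g$, the cycle-time vector is $\chi(g)=\lim_{k\to\infty}g^k(x)/k$ (independent of $x\in\mathbb{R}^{n+1}$), and $\chi(\overline{A}B)=\chi(f)$ for the min-max function $f$. Max and min of vectors in (ii) are componentwise. $G^\sigma$ is the one-player game obtained by fixing Max's strategy $\sigma$.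 A cycle $\gamma$ in $G^\sigma$ is accessible from $j$ if there is a directed path in $G^\sigma$ from $j$ to some node of $\gamma$. For a cycle $\gamma$: $k_1(\gamma)$ is the number of its arcs carrying weight $\lambda_1$ (outgoing from Max nodes in $C_2\cup C_3$), $k_2(\gamma)$ the number of its arcs carrying weight $\lambda_2$ (outgoing from $C_4\cup C_5$), $s(\gamma)$ is the sum of the weights of all its remaining arcs ($-a_{ij}$ for Min-to-Max arcs, $b_{ij}$ for Max-to-Min arcs from $C_1$), and $|\gamma|$ is its length, i.e. the total number of its arcs.
   Formalization: Adds that every column of A has an entry ≠ −∞ (else 𝒯 is empty and χ infinite); cycle means in (iii) divide by |γ|/2, since a turn is two arcs; the false "one outgoing arc, exactly one cycle" becomes: each Max node has one outgoing arc, and every node reaches at least one cycle. *)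

theory Defs
  imports "HOL-Analysis.Analysis" "Graph_Theory.Arc_Walk"
begin

section \<open>Max-plus algebra and the optimization problem\<close>

text \<open>
  Elements of \<open>\<real>\<close> with \<open>-\<infinity>\<close> and/or \<open>+\<infinity>\<close> adjoined are extended reals; the theorem excludes
  the infinity that is not allowed. The negation on extended reals is the conjugation of the
  max-plus conventions, \<open>- \<infinity> \<mapsto> -\<infinity>\<close> and \<open>- (-\<infinity>) = \<infinity>\<close>. The ambiguous sum \<open>\<infinity> + (-\<infinity>)\<close> never
  occurs below as long as \<open>A\<close> and \<open>B\<close> have no entry \<open>\<infinity>\<close>, every row of \<open>B\<close> has a finite entry and
  vectors are finite.
\<close>

definition ereal_vec :: "real ^ 'n \<Rightarrow> ereal ^ 'n" where
  "ereal_vec x = (\<chi> i. ereal (x $ i))"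

definition mp_mult :: "ereal ^ 'n ^ 'm \<Rightarrow> ereal ^ 'n \<Rightarrow> ereal ^ 'm" where
  "mp_mult M x = (\<chi> i. MAX j. M $ i $ j + x $ j)"

definition objective :: "ereal ^ 'n \<Rightarrow> ereal ^ 'n \<Rightarrow> real ^ 'n \<Rightarrow> ereal" where
  "objective p q x = max (MAX j. p $ j - ereal (x $ j)) (MAX j. ereal (x $ j) - q $ j)"

definition feasible ::
  "ereal ^ 'n ^ 'm \<Rightarrow> ereal ^ 'm \<Rightarrow> ereal ^ 'n ^ 'm \<Rightarrow> ereal ^ 'm \<Rightarrow> real ^ 'n \<Rightarrow> bool" where
  "feasible U b V d x \<longleftrightarrow>
     (\<forall>i. max (mp_mult U (ereal_vec x) $ i) (b $ i) \<le> max (mp_mult V (ereal_vec x) $ i) (d $ i))"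

definition feasibility_region ::
  "ereal ^ 'n ^ 'm \<Rightarrow> ereal ^ 'm \<Rightarrow> ereal ^ 'n ^ 'm \<Rightarrow> ereal ^ 'm \<Rightarrow>
   ereal ^ 'n \<Rightarrow> ereal ^ 'n \<Rightarrow> ereal ^ 'n \<Rightarrow> ereal ^ 'n \<Rightarrow> (real \<times> real) set" where
  "feasibility_region U b V d p1 q1 p2 q2 =
     {(l1, l2). \<exists>x :: real ^ 'n. feasible U b V d x \<and>
        objective p1 q1 x \<le> ereal l1 \<and> objective p2 q2 x \<le> ereal l2}"


section \<open>The block matrices\<close>

text \<open>
  Rows and columns are indexed by their groups: \<open>m + n + 1 + n + 1\<close> rows and \<open>n + 1\<close> columns for
  \<open>m = CARD('m)\<close> and \<open>n = CARD('n)\<close>.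
\<close>

datatype ('m, 'n) row = C1 'm | C2 'n | C3 | C4 'n | C5

datatype 'n col = Col 'n | Last

instance row :: (finite, finite) finite
proof
  have eq: "(UNIV :: ('a, 'b) row set) = range C1 \<union> range C2 \<union> {C3} \<union> range C4 \<union> {C5}"
  proof (intro set_eqI iffI UNIV_I)
    fix r :: "('a, 'b) row"
    show "r \<in> range C1 \<union> range C2 \<union> {C3} \<union> range C4 \<union> {C5}"
      by (cases r) simp_all
  qed
  show "finite (UNIV :: ('a, 'b) row set)"
    unfolding eq by simp
qed

instance col :: (finite) finite
proof
  have eq: "(UNIV :: 'a col set) = insert Last (range Col)"
  proof (intro set_eqI iffI UNIV_I)
    fix c :: "'a col"
    show "c \<in> insert Last (range Col)"
      by (cases c) simp_all
  qed
  show "finite (UNIV :: 'a col set)"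
    unfolding eq by simp
qed

fun A_entry ::
  "ereal ^ 'n ^ 'm \<Rightarrow> ereal ^ 'm \<Rightarrow> ereal ^ 'n \<Rightarrow> ereal ^ 'n \<Rightarrow> ereal ^ 'n \<Rightarrow> ereal ^ 'n \<Rightarrow>
   ('m, 'n) row \<Rightarrow> 'n col \<Rightarrow> ereal" where
  "A_entry U b p1 q1 p2 q2 (C1 i) (Col j) = U $ i $ j"
| "A_entry U b p1 q1 p2 q2 (C1 i) Last = b $ i"
| "A_entry U b p1 q1 p2 q2 (C2 i) (Col j) = -\<infinity>"
| "A_entry U b p1 q1 p2 q2 (C2 i) Last = p1 $ i"
| "A_entry U b p1 q1 p2 q2 C3 (Col j) = - (q1 $ j)"
| "A_entry U b p1 q1 p2 q2 C3 Last = -\<infinity>"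
| "A_entry U b p1 q1 p2 q2 (C4 i) (Col j) = -\<infinity>"
| "A_entry U b p1 q1 p2 q2 (C4 i) Last = p2 $ i"
| "A_entry U b p1 q1 p2 q2 C5 (Col j) = - (q2 $ j)"
| "A_entry U b p1 q1 p2 q2 C5 Last = -\<infinity>"

definition A_mat ::
  "ereal ^ 'n ^ 'm \<Rightarrow> ereal ^ 'm \<Rightarrow> ereal ^ 'n \<Rightarrow> ereal ^ 'n \<Rightarrow> ereal ^ 'n \<Rightarrow> ereal ^ 'n \<Rightarrow>
   ereal ^ 'n col ^ ('m :: finite, 'n :: finite) row" where
  "A_mat U b p1 q1 p2 q2 = (\<chi> r c. A_entry U b p1 q1 p2 q2 r c)"

fun Vd_entry :: "ereal ^ 'n ^ 'm \<Rightarrow> ereal ^ 'm \<Rightarrow> 'm \<Rightarrow> 'n col \<Rightarrow> ereal" where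
  "Vd_entry V d i (Col j) = V $ i $ j"
| "Vd_entry V d i Last = d $ i"

fun B_entry ::
  "ereal ^ 'n ^ 'm \<Rightarrow> ereal ^ 'm \<Rightarrow> real \<Rightarrow> real \<Rightarrow> ('m, 'n) row \<Rightarrow> 'n col \<Rightarrow> ereal" where
  "B_entry V d l1 l2 (C1 i) c = Vd_entry V d i c"
| "B_entry V d l1 l2 (C2 i) c = (if c = Col i then ereal l1 else -\<infinity>)"
| "B_entry V d l1 l2 C3 c = (if c = Last then ereal l1 else -\<infinity>)"
| "B_entry V d l1 l2 (C4 i) c = (if c = Col i then ereal l2 else -\<infinity>)"
| "B_entry V d l1 l2 C5 c = (if c = Last then ereal l2 else -\<infinity>)"

definition B_mat ::
  "ereal ^ 'n ^ 'm \<Rightarrow> ereal ^ 'm \<Rightarrow> real \<Rightarrow> real \<Rightarrow>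
   ereal ^ 'n col ^ ('m :: finite, 'n :: finite) row" where
  "B_mat V d l1 l2 = (\<chi> r c. B_entry V d l1 l2 r c)"


section \<open>Min-max functions and cycle-time vectors\<close>

definition max_strategies :: "ereal ^ 'c ^ 'r \<Rightarrow> ('r \<Rightarrow> 'c) set" where
  "max_strategies B = {\<sigma>. \<forall>i. B $ i $ \<sigma> i \<noteq> -\<infinity>}"

definition min_strategies :: "ereal ^ 'c ^ 'r \<Rightarrow> ('c \<Rightarrow> 'r) set" where
  "min_strategies A = {\<tau>. \<forall>j. A $ \<tau> j $ j \<noteq> -\<infinity>}"

definition minmax_fun ::
  "ereal ^ 'c ^ 'r \<Rightarrow> ereal ^ 'c ^ 'r \<Rightarrow> ereal ^ 'c \<Rightarrow> ereal ^ 'c" where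
  "minmax_fun A B x = (\<chi> j. MIN i. - (A $ i $ j) + mp_mult B x $ i)"

definition fun_max_strat ::
  "ereal ^ 'c ^ 'r \<Rightarrow> ereal ^ 'c ^ 'r \<Rightarrow> ('r \<Rightarrow> 'c) \<Rightarrow> ereal ^ 'c \<Rightarrow> ereal ^ 'c" where
  "fun_max_strat A B \<sigma> x = (\<chi> j. MIN i. - (A $ i $ j) + B $ i $ \<sigma> i + x $ \<sigma> i)"

definition fun_min_strat ::
  "ereal ^ 'c ^ 'r \<Rightarrow> ereal ^ 'c ^ 'r \<Rightarrow> ('c \<Rightarrow> 'r) \<Rightarrow> ereal ^ 'c \<Rightarrow> ereal ^ 'c" where
  "fun_min_strat A B \<tau> x = (\<chi> j. - (A $ \<tau> j $ j) + (MAX l. B $ \<tau> j $ l + x $ l))"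

definition has_cycle_time :: "(ereal ^ 'c \<Rightarrow> ereal ^ 'c) \<Rightarrow> real ^ 'c \<Rightarrow> bool" where
  "has_cycle_time g v \<longleftrightarrow>
     (\<forall>x :: real ^ 'c. \<forall>j.
        (\<lambda>k. (g ^^ k) (ereal_vec x) $ j / ereal (real k)) \<longlonglongrightarrow> ereal (v $ j))"

text \<open>Only meaningful together with a proof that some vector is a cycle-time vector of \<open>g\<close>.\<close>

definition cycle_time :: "(ereal ^ 'c \<Rightarrow> ereal ^ 'c) \<Rightarrow> real ^ 'c" where
  "cycle_time g = (THE v. has_cycle_time g v)"


section \<open>The mean-payoff game\<close>

text \<open>
  General (history-dependent) strategies. A history is given by the list of the Min nodes (columns)
  and the list of the Max nodes (rows) visited so far; it ends with a Max node when Max is to move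
  and with a Min node when Min is to move.
\<close>

type_synonym ('r, 'c) max_policy = "'c list \<Rightarrow> 'r list \<Rightarrow> 'c"
type_synonym ('r, 'c) min_policy = "'c list \<Rightarrow> 'r list \<Rightarrow> 'r"

definition max_policies :: "ereal ^ 'c ^ 'r \<Rightarrow> ('r, 'c) max_policy set" where
  "max_policies B = {\<phi>. \<forall>cs rs. rs \<noteq> [] \<longrightarrow> B $ last rs $ \<phi> cs rs \<noteq> -\<infinity>}"

definition min_policies :: "ereal ^ 'c ^ 'r \<Rightarrow> ('r, 'c) min_policy set" where
  "min_policies A = {\<psi>. \<forall>cs rs. cs \<noteq> [] \<longrightarrow> A $ \<psi> cs rs $ last cs \<noteq> -\<infinity>}"

definition positional_max :: "('r \<Rightarrow> 'c) \<Rightarrow> ('r, 'c) max_policy" where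
  "positional_max \<sigma> = (\<lambda>cs rs. \<sigma> (last rs))"

definition positional_min :: "('c \<Rightarrow> 'r) \<Rightarrow> ('r, 'c) min_policy" where
  "positional_min \<tau> = (\<lambda>cs rs. \<tau> (last cs))"

primrec history ::
  "('r, 'c) max_policy \<Rightarrow> ('r, 'c) min_policy \<Rightarrow> 'c \<Rightarrow> nat \<Rightarrow> 'c list \<times> 'r list" where
  "history \<phi> \<psi> j 0 = ([j], [])"
| "history \<phi> \<psi> j (Suc t) =
     (let (cs, rs) = history \<phi> \<psi> j t; rs' = rs @ [\<psi> cs rs] in (cs @ [\<phi> cs rs'], rs'))"

definition min_node_at ::
  "('r, 'c) max_policy \<Rightarrow> ('r, 'c) min_policy \<Rightarrow> 'c \<Rightarrow> nat \<Rightarrow> 'c" where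
  "min_node_at \<phi> \<psi> j t = last (fst (history \<phi> \<psi> j t))"

definition max_node_at ::
  "('r, 'c) max_policy \<Rightarrow> ('r, 'c) min_policy \<Rightarrow> 'c \<Rightarrow> nat \<Rightarrow> 'r" where
  "max_node_at \<phi> \<psi> j t = last (snd (history \<phi> \<psi> j (Suc t)))"

text \<open>
  A turn consists of a move of Min followed by a move of Max, that is, of one application of the
  min-max function.
\<close>

definition mean_payoff ::
  "ereal ^ 'c ^ 'r \<Rightarrow> ereal ^ 'c ^ 'r \<Rightarrow> ('r, 'c) max_policy \<Rightarrow> ('r, 'c) min_policy \<Rightarrow>
   'c \<Rightarrow> nat \<Rightarrow> ereal" where
  "mean_payoff A B \<phi> \<psi> j N =
     (\<Sum>t<N. - (A $ max_node_at \<phi> \<psi> j t $ min_node_at \<phi> \<psi> j t)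
            + B $ max_node_at \<phi> \<psi> j t $ min_node_at \<phi> \<psi> j (Suc t)) / ereal (real N)"

text \<open>
  The long-run average need not exist for general strategies; Max is credited with the limit
  inferior in the lower value and with the limit superior in the upper value, so that equality of
  the two is the strongest form of the existence of the value.
\<close>

definition lower_value :: "ereal ^ 'c ^ 'r \<Rightarrow> ereal ^ 'c ^ 'r \<Rightarrow> 'c \<Rightarrow> ereal" where
  "lower_value A B j =
     (SUP \<phi>\<in>max_policies B. INF \<psi>\<in>min_policies A. liminf (mean_payoff A B \<phi> \<psi> j))"

definition upper_value :: "ereal ^ 'c ^ 'r \<Rightarrow> ereal ^ 'c ^ 'r \<Rightarrow> 'c \<Rightarrow> ereal" where
  "upper_value A B j =
     (INF \<psi>\<in>min_policies A. SUP \<phi>\<in>max_policies B. limsup (mean_payoff A B \<phi> \<psi> j))"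

definition is_game_value :: "ereal ^ 'c ^ 'r \<Rightarrow> ereal ^ 'c ^ 'r \<Rightarrow> real ^ 'c \<Rightarrow> bool" where
  "is_game_value A B v \<longleftrightarrow>
     (\<forall>j. lower_value A B j = ereal (v $ j) \<and> upper_value A B j = ereal (v $ j))"

definition max_secures ::
  "ereal ^ 'c ^ 'r \<Rightarrow> ereal ^ 'c ^ 'r \<Rightarrow> ('r, 'c) max_policy \<Rightarrow> 'c \<Rightarrow> real \<Rightarrow> bool" where
  "max_secures A B \<phi> j v \<longleftrightarrow>
     (\<forall>\<psi>\<in>min_policies A. ereal v \<le> liminf (mean_payoff A B \<phi> \<psi> j))"

definition min_secures ::
  "ereal ^ 'c ^ 'r \<Rightarrow> ereal ^ 'c ^ 'r \<Rightarrow> ('r, 'c) min_policy \<Rightarrow> 'c \<Rightarrow> real \<Rightarrow> bool" where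
  "min_secures A B \<psi> j v \<longleftrightarrow>
     (\<forall>\<phi>\<in>max_policies B. limsup (mean_payoff A B \<phi> \<psi> j) \<le> ereal v)"


section \<open>The one-player game of a strategy of Max\<close>

datatype ('r, 'c) node = Max_node 'r | Min_node 'c

type_synonym ('r, 'c) arc = "('r, 'c) node \<times> ('r, 'c) node"

definition one_player_game ::
  "ereal ^ 'c ^ 'r \<Rightarrow> ('r \<Rightarrow> 'c) \<Rightarrow> (('r, 'c) node, ('r, 'c) arc) pre_digraph" where
  "one_player_game A \<sigma> =
     \<lparr> verts = UNIV,
       arcs = {(Min_node j, Max_node i) | j i. A $ i $ j \<noteq> -\<infinity>} \<union>
              {(Max_node i, Min_node (\<sigma> i)) | i. True},
       tail = fst, head = snd \<rparr>"

definition accessible :: "('v, 'e) pre_digraph \<Rightarrow> 'v \<Rightarrow> 'e list \<Rightarrow> bool" where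
  "accessible G v \<gamma> \<longleftrightarrow> (\<exists>e\<in>set \<gamma>. v \<rightarrow>\<^sup>*\<^bsub>G\<^esub> tail G e)"

definition elementary_cycles :: "('v, 'e) pre_digraph \<Rightarrow> 'v \<Rightarrow> 'e list set" where
  "elementary_cycles G v = {\<gamma>. pre_digraph.cycle G \<gamma> \<and> accessible G v \<gamma>}"

definition closed_walks :: "('v, 'e) pre_digraph \<Rightarrow> 'v \<Rightarrow> 'e list set" where
  "closed_walks G v = {\<gamma>. wf_digraph.closed_w G \<gamma> \<and> accessible G v \<gamma>}"

definition k1 :: "(('m, 'n) row, 'n col) arc list \<Rightarrow> nat" where
  "k1 \<gamma> = length [e \<leftarrow> \<gamma>. fst e \<in> Max_node ` (range C2 \<union> {C3})]"

definition k2 :: "(('m, 'n) row, 'n col) arc list \<Rightarrow> nat" where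
  "k2 \<gamma> = length [e \<leftarrow> \<gamma>. fst e \<in> Max_node ` (range C4 \<union> {C5})]"

text \<open>
  The weight of an arc not carrying \<open>\<lambda>\<^sub>1\<close> or \<open>\<lambda>\<^sub>2\<close>, and 0 for the arcs that do; it is finite on all
  arcs of the one-player game of a strategy of Max.
\<close>

fun rest_weight ::
  "ereal ^ 'n col ^ ('m :: finite, 'n :: finite) row \<Rightarrow> ereal ^ 'n ^ 'm \<Rightarrow> ereal ^ 'm \<Rightarrow>
   (('m, 'n) row, 'n col) arc \<Rightarrow> ereal" where
  "rest_weight A V d (Min_node c, Max_node r) = - (A $ r $ c)"
| "rest_weight A V d (Max_node (C1 i), Min_node c) = Vd_entry V d i c"
| "rest_weight A V d _ = 0"

definition rest_sum ::
  "ereal ^ 'n col ^ ('m :: finite, 'n :: finite) row \<Rightarrow> ereal ^ 'n ^ 'm \<Rightarrow> ereal ^ 'm \<Rightarrow>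
   (('m, 'n) row, 'n col) arc list \<Rightarrow> real" where
  "rest_sum A V d \<gamma> = real_of_ereal (\<Sum>e\<leftarrow>\<gamma>. rest_weight A V d e)"

text \<open>
  The mean per turn. The length of \<open>\<gamma>\<close> counts all arcs, and each turn, that is, each application
  of the functions above, traverses two of them, so a cycle lasts \<open>length \<gamma> / 2\<close> turns.
\<close>

definition cycle_mean ::
  "ereal ^ 'n col ^ ('m :: finite, 'n :: finite) row \<Rightarrow> ereal ^ 'n ^ 'm \<Rightarrow> ereal ^ 'm \<Rightarrow>
   real \<Rightarrow> real \<Rightarrow> (('m, 'n) row, 'n col) arc list \<Rightarrow> real" where
  "cycle_mean A V d l1 l2 \<gamma> =
     (real (k1 \<gamma>) * l1 + real (k2 \<gamma>) * l2 + rest_sum A V d \<gamma>) / (real (length \<gamma>) / 2)"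

definition piecewise_linear :: "('a :: euclidean_space \<Rightarrow> real) \<Rightarrow> bool" where
  "piecewise_linear f \<longleftrightarrow>
     (\<exists>\<P>. finite \<P> \<and> \<Union>\<P> = UNIV \<and>
        (\<forall>P\<in>\<P>. polyhedron P \<and> (\<exists>a c. \<forall>x\<in>P. f x = a \<bullet> x + c)))"

end

theory Submission
  imports Defs
begin

text \<open>
  Everything follows from Kohlberg's theorem: there are vectors \<open>u\<close> and \<open>\<eta>\<close> such that the min-max
  function maps \<open>u + t \<eta>\<close> to \<open>u + (t + 1) \<eta>\<close> for all large \<open>t\<close>. To find them, consider fixed points of the
  games with discount factor \<open>1 - 1 / (n + 1)\<close>. For infinitely many \<open>n\<close> the same pair of positional
  strategies is optimal, and its discounted payoff is \<open>(n + 1) \<eta> + u + O(1 / n)\<close>. Hence the half-line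
  equation holds up to \<open>O(1 / n)\<close> infinitely often; since the min-max function is affine far out on the
  half-line, it holds exactly.

  Then \<open>\<eta>\<close> is the cycle-time vector, because the function is monotone and additively homogeneous. The
  strategies that are optimal far out on the half-line are optimal in the game, as the payoff of a
  play telescopes against \<open>u + t \<eta>\<close>. Reading \<open>u + t \<eta>\<close> as a potential on the one-player game bounds the mean of
  every closed walk from below, with equality on the cycle that an optimal strategy of Min runs
  into. Finally, \<open>\<eta> \<ge> 0\<close> makes \<open>u + t \<eta>\<close> a point that the function does not decrease, which is
  feasibility.
\<close>

section \<open>Deterministic discounted payoffs\<close>

text \<open>When the value depends on the starting node, no vector u satisfies f(u) = u + c with a
  constant c. A half-line with its own slope at every node is the substitute: it tolerates different
  values, and beyond some \<open>T\<close> the moves that are best on it no longer change. The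
  discount factor n/(n+1) is chosen so that 1/(1 - \<alpha>) = n + 1 and \<alpha> times the
  discounted value vector is u + n \<eta> + O(1/n); the discounted fixed-point equation thereby
  turns into the half-line equation at parameter n. The precision O(1/n) is essential: a merely
  bounded error would determine the slope \<eta> only, whereas an error that tends to 0 also
  determines u, since an affine function of n that tends to 0 along an infinite set vanishes.
  One-player games are covered by the same theorem: forbidding all moves but those of a fixed
  strategy gives a game of the same kind.\<close>

lemma funpow_eventually_idempotent:
  fixes s :: "'a::finite \<Rightarrow> 'a"
  obtains N where "N > 0" "s ^^ (N + N) = s ^^ N"
proof -
  have "\<not> inj (\<lambda>n::nat. s ^^ n)"
    using finite_imageD[of "\<lambda>n::nat. s ^^ n" UNIV] by auto
  then obtain i j where ij: "i < j" "s ^^ i = s ^^ j"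
    unfolding inj_on_def by (metis linorder_neqE_nat)
  define p where "p = j - i"
  have p: "p > 0" "s ^^ (i + p) = s ^^ i"
    using ij by (auto simp: p_def)
  have shift: "s ^^ (n + k * p) = s ^^ n" if "n \<ge> i" for n k
  proof (induction k)
    case (Suc k)
    have "s ^^ (n + Suc k * p) = s ^^ (n - i + k * p) \<circ> s ^^ (i + p)"
      using that by (simp add: funpow_add[symmetric] algebra_simps)
    also have "\<dots> = s ^^ (n - i + k * p + i)"
      unfolding p(2) by (simp add: funpow_add)
    also have "n - i + k * p + i = n + k * p"
      using that by simp
    finally show ?case
      using Suc by simp
  qed simp
  show thesis
  proof (rule that)
    \<comment> \<open>Any positive multiple of the period past the preperiod \<open>i\<close> is an
      idempotent exponent; the factor \<open>Suc i\<close> keeps it positive when \<open>i\<close>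
      is 0.\<close>
    show "Suc i * p > 0" using p(1) by simp
    have "i \<le> Suc i * p" using p(1) by (cases p) auto
    then show "s ^^ (Suc i * p + Suc i * p) = s ^^ (Suc i * p)" by (rule shift)
  qed
qed

text \<open>After \<open>N\<close> steps every orbit is inside its cycle, and \<open>N\<close> is a
  multiple of every cycle length, so averages over the steps \<open>N\<close>, ...,
  \<open>N + N - 1\<close> are cycle averages: \<open>\<eta>\<close> averages \<open>g\<close>, and
  \<open>u\<close> averages the partial sums \<open>S\<close> of \<open>g - \<eta>\<close>, which in
  general do not converge but are eventually periodic.\<close>

lemma Poisson_equation:
  fixes s :: "'a::finite \<Rightarrow> 'a" and g :: "'a \<Rightarrow> real"
  obtains \<eta> u where "\<And>j. \<eta> (s j) = \<eta> j" "\<And>j. \<eta> j + u j = g j + u (s j)"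
proof -
  obtain N where N: "N > 0" "s ^^ (N + N) = s ^^ N"
    by (rule funpow_eventually_idempotent)
  have sum_shift: "(\<Sum>k=m..<m+N. f (Suc k)) = (\<Sum>k=m..<m+N. f k) + f (m + N) - f m"
    for f :: "nat \<Rightarrow> real" and m
  proof -
    have "(\<Sum>k=m..<m+N. f (Suc k)) - (\<Sum>k=m..<m+N. f k) = (\<Sum>k=m..<m+N. f (Suc k) - f k)"
      by (simp add: sum_subtractf)
    also have "\<dots> = f (m + N) - f m"
      by (rule sum_Suc_diff') simp
    finally show ?thesis by simp
  qed
  define \<eta> where "\<eta> j = (\<Sum>k=N..<N+N. g ((s ^^ k) j)) / N" for j
  have \<eta>: "\<eta> (s j) = \<eta> j" for j
  proof -
    have "(\<Sum>k=N..<N+N. g ((s ^^ k) (s j))) = (\<Sum>k=N..<N+N. g ((s ^^ Suc k) j))"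
      by (simp add: funpow_swap1)
    then show ?thesis
      unfolding \<eta>_def using sum_shift[of "\<lambda>k. g ((s ^^ k) j)" N] N(2) by simp
  qed
  define S where "S k j = (\<Sum>t<k. g ((s ^^ t) j) - \<eta> j)" for k j
  define u where "u j = (\<Sum>k=N..<N+N. S k j) / N" for j
  have S_Suc: "S (Suc k) j = g j - \<eta> j + S k (s j)" for k j
    unfolding S_def sum.lessThan_Suc_shift by (simp add: funpow_swap1 \<eta>)
  have "S (N + N) j = S N j" for j
  proof -
    have "S (N + N) j = S N j + (\<Sum>t=N..<N+N. g ((s ^^ t) j) - \<eta> j)"
      unfolding S_def lessThan_atLeast0 by (rule sum.atLeastLessThan_concat[symmetric]) auto
    \<comment> \<open>By the choice of \<open>\<eta>\<close>, one full window cancels.\<close>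
    also have "(\<Sum>t=N..<N+N. g ((s ^^ t) j) - \<eta> j) = 0"
      using N(1) by (simp add: \<eta>_def sum_subtractf)
    finally show ?thesis by simp
  qed
  then have "(\<Sum>k=N..<N+N. S (Suc k) j) = (\<Sum>k=N..<N+N. S k j)" for j
    using sum_shift[of "\<lambda>k. S k j" N] by simp
  then have "N * (g j - \<eta> j) + (\<Sum>k=N..<N+N. S k (s j)) = (\<Sum>k=N..<N+N. S k j)" for j
    unfolding S_Suc sum.distrib by simp
  then have "\<eta> j + u j = g j + u (s j)" for j
    using N(1) by (simp add: u_def field_simps)
  with \<eta> show thesis by (rule that)
qed

lemma bounded_fun_finite:
  fixes f :: "'a::finite \<Rightarrow> real"
  obtains C where "C \<ge> 0" "\<And>j. \<bar>f j\<bar> \<le> C"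
proof
  show "0 \<le> (\<Sum>j\<in>UNIV. \<bar>f j\<bar>)" by (simp add: sum_nonneg)
  show "\<bar>f j\<bar> \<le> (\<Sum>j\<in>UNIV. \<bar>f j\<bar>)" for j
    by (rule member_le_sum) auto
qed

text \<open>Where the absolute value of \<open>e\<close> is maximal, its value at the successor is
  no larger, and the factor \<open>1 - \<alpha>\<close> cancels.\<close>

lemma discounted_contraction:
  fixes e :: "'a::finite \<Rightarrow> real"
  assumes "0 \<le> \<alpha>" "\<alpha> < 1"
    and e: "\<And>j. \<bar>e j\<bar> \<le> \<alpha> * \<bar>e (s j)\<bar> + (1 - \<alpha>) * c"
  shows "\<bar>e j\<bar> \<le> c"
proof -
  define m where "m = (MAX j. \<bar>e j\<bar>)"
  have le: "\<bar>e i\<bar> \<le> m" for i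
    unfolding m_def by (rule Max_ge) auto
  have "m \<in> range (\<lambda>j. \<bar>e j\<bar>)"
    unfolding m_def by (rule Max_in) auto
  then obtain i where "m = \<bar>e i\<bar>" by auto
  with e[of i] have "m \<le> \<alpha> * \<bar>e (s i)\<bar> + (1 - \<alpha>) * c" by simp
  also have "\<alpha> * \<bar>e (s i)\<bar> \<le> \<alpha> * m"
    using le assms(1) by (rule mult_left_mono)
  finally have "(1 - \<alpha>) * m \<le> (1 - \<alpha>) * c" by (simp add: algebra_simps)
  then have "m \<le> c" using assms(2) by simp
  with le[of j] show ?thesis by simp
qed

text \<open>
  The first two terms of the expansion in \<open>1 - \<alpha>\<close>. The Poisson equation is solved a second time because
  \<open>u\<close> is determined by \<open>g\<close> only up to an invariant function, which the next order of the expansion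
  fixes.
\<close>

lemma discounted_expansion:
  fixes s :: "'a::finite \<Rightarrow> 'a" and g :: "'a \<Rightarrow> real"
  obtains \<eta> u C where "\<And>\<alpha> x j. 0 \<le> \<alpha> \<Longrightarrow> \<alpha> < 1 \<Longrightarrow> (\<And>i. x i = g i + \<alpha> * x (s i)) \<Longrightarrow>
    \<bar>x j - (\<eta> j / (1 - \<alpha>) + u j)\<bar> \<le> C * (1 - \<alpha>)"
proof -
  obtain \<eta> u0 where \<eta>: "\<And>j. \<eta> (s j) = \<eta> j" and u0: "\<And>j. \<eta> j + u0 j = g j + u0 (s j)"
    using Poisson_equation[of s g] by blast
  \<comment> \<open>The next order of the expansion is solvable only if \<open>u\<close> has mean 0
    on every cycle of \<open>s\<close>. Adding the invariant function \<open>\<zeta>\<close>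
    achieves this, as \<open>u (s j)\<close> becomes the difference
    \<open>w (s j) - w j\<close>.\<close>
  obtain \<zeta> w where \<zeta>: "\<And>j. \<zeta> (s j) = \<zeta> j" and w: "\<And>j. \<zeta> j + w j = - u0 (s j) + w (s j)"
    using Poisson_equation[of s "\<lambda>j. - u0 (s j)"] by blast
  define u where "u j = u0 j + \<zeta> j" for j
  have u: "\<eta> j + u j = g j + u (s j)" and uw: "u (s j) = w (s j) - w j" for j
    using u0[of j] w[of j] by (auto simp: u_def \<zeta>)
  obtain C where C: "C \<ge> 0" "\<And>j. \<bar>w j\<bar> \<le> C"
    using bounded_fun_finite[of w] by blast
  show thesis
  proof (rule that)
    fix \<alpha> :: real and x j
    assume \<alpha>: "0 \<le> \<alpha>" "\<alpha> < 1" and x: "\<And>i. x i = g i + \<alpha> * x (s i)"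
    \<comment> \<open>Subtracting also the third term \<open>(1 - \<alpha>) * w j\<close> leaves a
      remainder whose source is of order (1 - \<alpha>)^2; the contraction costs one of the two
      factors.\<close>
    define e where "e j = x j - (\<eta> j / (1 - \<alpha>) + u j) - (1 - \<alpha>) * w j" for j
    have e_eq: "e i = \<alpha> * e (s i) - (1 - \<alpha>) * ((1 - \<alpha>) * w (s i))" for i
    proof -
      define z where "z = \<eta> i / (1 - \<alpha>)"
      have z: "z = \<eta> i + \<alpha> * z"
        using \<alpha> by (simp add: z_def field_simps)
      have "e i - \<alpha> * e (s i) = (g i + \<alpha> * x (s i)) - (z + u i) - (1 - \<alpha>) * w i
          - \<alpha> * (x (s i) - (z + u (s i)) - (1 - \<alpha>) * w (s i))"
        unfolding e_def x[of i, symmetric] by (simp add: \<eta> z_def)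
      also have "\<dots> = (g i - \<eta> i - u i + u (s i)) + (\<eta> i + \<alpha> * z - z)
          - (1 - \<alpha>) * (u (s i) + w i - \<alpha> * w (s i))"
        by (simp add: algebra_simps)
      also have "\<dots> = - (1 - \<alpha>) * ((1 - \<alpha>) * w (s i))"
        using u[of i] z unfolding uw by (simp add: algebra_simps)
      finally show ?thesis by (simp add: algebra_simps)
    qed
    have "\<bar>e i\<bar> \<le> \<alpha> * \<bar>e (s i)\<bar> + (1 - \<alpha>) * ((1 - \<alpha>) * C)" for i
    proof -
      have "\<bar>e i\<bar> \<le> \<bar>\<alpha> * e (s i)\<bar> + \<bar>(1 - \<alpha>) * ((1 - \<alpha>) * w (s i))\<bar>"
        unfolding e_eq[of i] by (rule abs_triangle_ineq4)
      also have "\<dots> = \<alpha> * \<bar>e (s i)\<bar> + (1 - \<alpha>) * ((1 - \<alpha>) * \<bar>w (s i)\<bar>)"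
        using \<alpha> by (simp add: abs_mult)
      also have "\<dots> \<le> \<alpha> * \<bar>e (s i)\<bar> + (1 - \<alpha>) * ((1 - \<alpha>) * C)"
        using \<alpha> C by (intro add_left_mono mult_left_mono) auto
      finally show ?thesis .
    qed
    with \<alpha> have "\<bar>e j\<bar> \<le> (1 - \<alpha>) * C"
      by (rule discounted_contraction)
    moreover have "\<bar>(1 - \<alpha>) * w j\<bar> \<le> (1 - \<alpha>) * C"
      using \<alpha> C by (simp add: abs_mult)
    moreover have "x j - (\<eta> j / (1 - \<alpha>) + u j) = e j + (1 - \<alpha>) * w j"
      by (simp add: e_def)
    \<comment> \<open>One \<open>C\<close> bounds the remainder, the other the third term put
      back.\<close>
    ultimately show "\<bar>x j - (\<eta> j / (1 - \<alpha>) + u j)\<bar> \<le> (2 * C) * (1 - \<alpha>)"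
      by (simp add: algebra_simps)
  qed
qed

section \<open>Affine functions of a large real parameter\<close>

lemma eventually_affine_le_total:
  fixes c d c' d' :: real
  shows "(\<forall>\<^sub>F t in at_top. c + t * d \<le> c' + t * d') \<or> (\<forall>\<^sub>F t in at_top. c' + t * d' \<le> c + t * d)"
proof -
  have *: "\<forall>\<^sub>F t in at_top. a + t * e \<le> a' + t * e'" if "e < e'" for a a' e e' :: real
  proof (rule eventually_mono[OF eventually_ge_at_top[of "(a - a') / (e' - e)"]])
    fix t assume "(a - a') / (e' - e) \<le> t"
    then show "a + t * e \<le> a' + t * e'"
      using that by (simp add: field_simps)
  qed
  consider "d < d'" | "d' < d" | "d = d'" "c \<le> c'" | "d = d'" "c' \<le> c" by linarith
  then show ?thesis by cases (auto intro: *)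
qed

text \<open>Two affine functions are eventually ordered, so induction over the finite index set
  keeps a current winner. The winning index is the same for all large \<open>t\<close>, which makes
  the best moves on a half-line positional.\<close>

lemma eventually_affine_max:
  fixes c d :: "'i \<Rightarrow> real"
  assumes "finite I" "I \<noteq> {}"
  shows "\<exists>i\<in>I. \<forall>\<^sub>F t in at_top. \<forall>k\<in>I. c k + t * d k \<le> c i + t * d i"
  using assms
proof (induction I rule: finite_ne_induct)
  case (insert m I)
  then obtain i where i: "i \<in> I" "\<forall>\<^sub>F t in at_top. \<forall>k\<in>I. c k + t * d k \<le> c i + t * d i"
    by blast
  from eventually_affine_le_total[of "c m" "d m" "c i" "d i"] show ?case
  proof
    assume "\<forall>\<^sub>F t in at_top. c m + t * d m \<le> c i + t * d i"
    with i(2) have "\<forall>\<^sub>F t in at_top. \<forall>k\<in>insert m I. c k + t * d k \<le> c i + t * d i"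
      by eventually_elim auto
    with i(1) show ?thesis by blast
  next
    assume "\<forall>\<^sub>F t in at_top. c i + t * d i \<le> c m + t * d m"
    with i(2) have "\<forall>\<^sub>F t in at_top. \<forall>k\<in>insert m I. c k + t * d k \<le> c m + t * d m"
      by eventually_elim (auto intro: order_trans)
    then show ?thesis by blast
  qed
qed simp

text \<open>A nonzero slope outgrows the bounded right-hand side; with slope 0, a nonzero constant
  contradicts the convergence of that side to 0.\<close>

lemma affine_zero_if_frequently_small:
  fixes c d C :: real
  assumes "infinite M" and small: "\<And>n::nat. n \<in> M \<Longrightarrow> \<bar>c + real n * d\<bar> \<le> C / (real n + 1)"
  shows "c = 0" "d = 0"
proof -
  \<comment> \<open>The pigeonhole principle supplies only an infinite set of indices; an eventual
    property still holds somewhere on it.\<close>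
  have ev: "\<forall>\<^sub>F n in sequentially. P n \<Longrightarrow> \<exists>n\<in>M. P n" for P
    using assms(1) unfolding eventually_sequentially infinite_nat_iff_unbounded_le by blast
  show d: "d = 0"
  proof (rule ccontr)
    assume "d \<noteq> 0"
    have "filterlim (\<lambda>n. \<bar>d\<bar> * real n) at_top sequentially"
      using \<open>d \<noteq> 0\<close> by (intro filterlim_tendsto_pos_mult_at_top[OF tendsto_const] filterlim_real_sequentially) auto
    then have "\<forall>\<^sub>F n in sequentially. \<bar>d\<bar> * real n > \<bar>c\<bar> + \<bar>C\<bar>"
      by (simp add: filterlim_at_top_dense)
    then obtain n where n: "n \<in> M" "\<bar>d\<bar> * real n > \<bar>c\<bar> + \<bar>C\<bar>"
      using ev by blast
    have "C / (real n + 1) \<le> \<bar>C\<bar> / 1"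
      by (intro frac_le) auto
    with small[OF n(1)] have "\<bar>c + real n * d\<bar> \<le> \<bar>C\<bar>" by simp
    moreover have "\<bar>real n * d\<bar> = \<bar>d\<bar> * real n" by (simp add: abs_mult)
    ultimately show False using n(2) by linarith
  qed
  show "c = 0"
  proof (rule ccontr)
    assume "c \<noteq> 0"
    have "(\<lambda>n. C / (real n + 1)) \<longlonglongrightarrow> 0"
      using tendsto_divide_0[OF tendsto_const filterlim_at_top_imp_at_infinity[OF
        filterlim_tendsto_add_at_top[OF tendsto_const[of 1] filterlim_real_sequentially]], of C]
      by (simp add: add.commute)
    then have "\<forall>\<^sub>F n in sequentially. C / (real n + 1) < \<bar>c\<bar>"
      using \<open>c \<noteq> 0\<close> by (intro order_tendstoD) auto
    then obtain n where "n \<in> M" "C / (real n + 1) < \<bar>c\<bar>"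
      using ev by blast
    with small[of n] d show False by simp
  qed
qed

section \<open>Invariant half-lines of min-max functions\<close>

text \<open>Entries \<open>-\<infinity>\<close> become missing moves, so that all payments here are
  real and the one-turn operator acts on real vectors.\<close>

locale real_game =
  fixes E :: "'c::finite \<Rightarrow> 'r::finite set" and F :: "'r \<Rightarrow> 'c set"
    and a :: "'r \<Rightarrow> 'c \<Rightarrow> real" and b :: "'r \<Rightarrow> 'c \<Rightarrow> real"
  assumes E_nonempty: "E j \<noteq> {}" and F_nonempty: "F i \<noteq> {}"
begin

definition row_max :: "('c \<Rightarrow> real) \<Rightarrow> 'r \<Rightarrow> real" where
  "row_max x i = (MAX l\<in>F i. b i l + x l)"

definition shapley :: "('c \<Rightarrow> real) \<Rightarrow> 'c \<Rightarrow> real" where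
  "shapley x j = (MIN i\<in>E j. a i j + row_max x i)"

lemma row_max_ge: "l \<in> F i \<Longrightarrow> b i l + x l \<le> row_max x i"
  unfolding row_max_def by (rule Max_ge) auto

lemma row_max_attained: obtains l where "l \<in> F i" "row_max x i = b i l + x l"
proof -
  have "row_max x i \<in> (\<lambda>l. b i l + x l) ` F i"
    unfolding row_max_def using F_nonempty by (intro Max_in) auto
  then show thesis using that by blast
qed

lemma shapley_le: "i \<in> E j \<Longrightarrow> shapley x j \<le> a i j + row_max x i"
  unfolding shapley_def by (rule Min_le) auto

lemma shapley_attained: obtains i where "i \<in> E j" "shapley x j = a i j + row_max x i"
proof -
  have "shapley x j \<in> (\<lambda>i. a i j + row_max x i) ` E j"
    unfolding shapley_def using E_nonempty by (intro Min_in) auto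
  then show thesis using that by blast
qed

text \<open>Monotonicity and additive homogeneity at once. Using Min's best row for \<open>y\<close>
  can only raise the value at \<open>x\<close>, and using Max's best column for \<open>x\<close> can
  only lower the value at \<open>y\<close>.\<close>

lemma shapley_le_shift:
  assumes "\<And>l. x l \<le> y l + c"
  shows "shapley x j \<le> shapley y j + c"
proof -
  obtain i where i: "i \<in> E j" "shapley y j = a i j + row_max y i"
    by (rule shapley_attained)
  obtain l where l: "l \<in> F i" "row_max x i = b i l + x l"
    by (rule row_max_attained)
  have "shapley x j \<le> a i j + row_max x i"
    using i(1) by (rule shapley_le)
  also have "\<dots> \<le> a i j + (b i l + y l) + c"
    using assms[of l] l(2) by simp
  also have "b i l + y l \<le> row_max y i"
    using l(1) by (rule row_max_ge)
  finally show ?thesis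
    using i(2) by simp
qed

lemma shapley_nonexpansive:
  assumes "\<And>l. \<bar>x l - y l\<bar> \<le> c"
  shows "\<bar>shapley x j - shapley y j\<bar> \<le> c"
proof -
  have "x l \<le> y l + c" "y l \<le> x l + c" for l
    using assms[of l] by linarith+
  then have "shapley x j \<le> shapley y j + c" "shapley y j \<le> shapley x j + c"
    by (blast intro: shapley_le_shift)+
  then show ?thesis by simp
qed

text \<open>The map contracts the sup norm but possibly not the Euclidean norm that the type
  carries, so the fixed point comes from Brouwer's theorem on a cube.\<close>

lemma discounted_fixed_point:
  assumes "0 \<le> \<alpha>" "\<alpha> < 1"
  obtains x where "\<And>j. shapley (\<lambda>l. \<alpha> * x l) j = x j"
proof -
  obtain K where K: "K \<ge> 0" "\<And>j. \<bar>shapley (\<lambda>_. 0) j\<bar> \<le> K"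
    using bounded_fun_finite[of "shapley (\<lambda>_. 0)"] by blast
  \<comment> \<open>The radius solves K + \<alpha> M = M: the origin is moved by at most
    \<open>K\<close>, and sup-norm distances shrink by the factor \<alpha>, so the cube of this
    radius is mapped into itself.\<close>
  define M where "M = K / (1 - \<alpha>)"
  have M: "M \<ge> 0" "K + \<alpha> * M = M"
    using K(1) assms by (auto simp: M_def field_simps)
  define S where "S = cbox (- (\<chi> j. M) :: real ^ 'c) (\<chi> j. M)"
  have S: "z \<in> S \<longleftrightarrow> (\<forall>j. \<bar>z $ j\<bar> \<le> M)" for z
    unfolding S_def mem_box_cart by (simp add: abs_le_iff) (meson minus_le_iff)
  define f :: "real ^ 'c \<Rightarrow> real ^ 'c" where "f z = (\<chi> j. shapley (\<lambda>l. \<alpha> * z $ l) j)" for z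
  have "continuous_on S (\<lambda>z. f z $ j)" for j
  proof (rule continuous_onI)
    fix z e assume "(e :: real) > 0"
    have "dist (f z' $ j) (f z $ j) \<le> dist z' z" for z'
      unfolding f_def dist_real_def vec_lambda_beta
    proof (rule shapley_nonexpansive)
      fix l
      have "\<bar>\<alpha> * z' $ l - \<alpha> * z $ l\<bar> = \<alpha> * \<bar>(z' - z) $ l\<bar>"
        using assms by (simp add: abs_mult right_diff_distrib[symmetric])
      also have "\<dots> \<le> 1 * \<bar>(z' - z) $ l\<bar>"
        using assms by (intro mult_right_mono) auto
      also have "\<dots> \<le> dist z' z"
        unfolding dist_norm using component_le_norm_cart[of "z' - z" l] by simp
      finally show "\<bar>\<alpha> * z' $ l - \<alpha> * z $ l\<bar> \<le> dist z' z" .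
    qed
    with \<open>e > 0\<close> show "\<exists>d>0. \<forall>z'\<in>S. dist z' z < d \<longrightarrow> dist (f z' $ j) (f z $ j) \<le> e"
      by (intro exI[of _ e]) (auto intro: order_trans less_imp_le)
  qed
  then have "continuous_on S (\<lambda>z. \<chi> j. f z $ j)"
    by (rule continuous_on_vec_lambda)
  then have "continuous_on S f" by simp
  moreover have "f z \<in> S" if "z \<in> S" for z
    unfolding S
  proof
    fix j
    have "\<bar>\<alpha> * z $ l - 0\<bar> \<le> \<alpha> * M" for l
      using that assms unfolding S by (simp add: abs_mult mult_left_mono)
    then have "\<bar>shapley (\<lambda>l. \<alpha> * z $ l) j - shapley (\<lambda>_. 0) j\<bar> \<le> \<alpha> * M"
      by (rule shapley_nonexpansive)
    with K(2)[of j] M(2) show "\<bar>f z $ j\<bar> \<le> M"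
      unfolding f_def vec_lambda_beta by linarith
  qed
  moreover have "0 \<in> S" using M(1) by (simp add: S)
  moreover have "compact S" "convex S" by (simp_all add: S_def compact_cbox)
  ultimately obtain z where "f z = z"
    using brouwer[of S f] by (metis empty_iff Pi_I)
  then have "shapley (\<lambda>l. \<alpha> * z $ l) j = z $ j" for j
    by (metis f_def vec_lambda_beta)
  then show thesis by (rule that)
qed

lemma optimal_decisions:
  obtains \<sigma> \<tau> where "\<And>i. \<sigma> i \<in> F i" "\<And>j. \<tau> j \<in> E j"
    "\<And>j. shapley x j = a (\<tau> j) j + b (\<tau> j) (\<sigma> (\<tau> j)) + x (\<sigma> (\<tau> j))"
proof -
  have "\<forall>i. \<exists>l. l \<in> F i \<and> row_max x i = b i l + x l"
    by (metis row_max_attained)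
  then obtain \<sigma> where \<sigma>: "\<And>i. \<sigma> i \<in> F i" "\<And>i. row_max x i = b i (\<sigma> i) + x (\<sigma> i)"
    by metis
  have "\<forall>j. \<exists>i. i \<in> E j \<and> shapley x j = a i j + row_max x i"
    by (metis shapley_attained)
  then obtain \<tau> where "\<And>j. \<tau> j \<in> E j" "\<And>j. shapley x j = a (\<tau> j) j + row_max x (\<tau> j)"
    by metis
  with \<sigma> show thesis by (intro that[of \<sigma> \<tau>]) (simp_all add: add.assoc)
qed

text \<open>Infinitely many \<open>n\<close> share one pair of optimal decisions, hence one
  successor map \<open>s\<close> and one payoff \<open>g\<close>, so a single expansion describes
  \<open>x n\<close> for all of them. Non-expansiveness transfers the estimate from the discounted
  vector to the point of the half-line at \<open>n\<close>.\<close>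

lemma approximate_half_line:
  obtains \<eta> u :: "'c \<Rightarrow> real" and C and M :: "nat set" where "infinite M"
    "\<And>n j. n \<in> M \<Longrightarrow>
      \<bar>shapley (\<lambda>l. u l + real n * \<eta> l) j - (u j + (real n + 1) * \<eta> j)\<bar> \<le> C / (real n + 1)"
proof -
  define \<alpha> where "\<alpha> n = real n / (real n + 1)" for n :: nat
  have \<alpha>: "0 \<le> \<alpha> n" "\<alpha> n < 1" "1 - \<alpha> n = 1 / (real n + 1)" for n
    by (auto simp: \<alpha>_def field_simps)
  have "\<forall>n. \<exists>x. \<forall>j. shapley (\<lambda>l. \<alpha> n * x l) j = x j"
    using \<alpha> by (metis discounted_fixed_point)
  then obtain x where x: "\<And>n j. shapley (\<lambda>l. \<alpha> n * x n l) j = x n j" by metis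
  have "\<exists>st. \<forall>j. shapley (\<lambda>l. \<alpha> n * x n l) j =
      a (snd st j) j + b (snd st j) (fst st (snd st j)) + \<alpha> n * x n (fst st (snd st j))" for n
  proof -
    obtain \<tau> \<sigma> where "\<And>j. shapley (\<lambda>l. \<alpha> n * x n l) j =
        a (\<tau> j) j + b (\<tau> j) (\<sigma> (\<tau> j)) + \<alpha> n * x n (\<sigma> (\<tau> j))"
      by (rule optimal_decisions[of "\<lambda>l. \<alpha> n * x n l"]) (rule that)
    then show ?thesis by (intro exI[of _ "(\<sigma>, \<tau>)"]) simp
  qed
  then obtain st where st: "\<And>n j. shapley (\<lambda>l. \<alpha> n * x n l) j = a (snd (st n) j) j +
      b (snd (st n) j) (fst (st n) (snd (st n) j)) + \<alpha> n * x n (fst (st n) (snd (st n) j))"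
    by metis
  have "finite (range st)" by simp
  then obtain n0 where "infinite {n. st n = st n0}"
    using pigeonhole_infinite[of UNIV st] by auto
  then obtain \<pi> where M: "infinite {n. st n = \<pi>}" by blast
  define s where "s j = fst \<pi> (snd \<pi> j)" for j
  define g where "g j = a (snd \<pi> j) j + b (snd \<pi> j) (s j)" for j
  obtain \<eta> u C where exp: "\<And>\<alpha> x j. 0 \<le> \<alpha> \<Longrightarrow> \<alpha> < 1 \<Longrightarrow> (\<And>i. x i = g i + \<alpha> * x (s i)) \<Longrightarrow>
      \<bar>x j - (\<eta> j / (1 - \<alpha>) + u j)\<bar> \<le> C * (1 - \<alpha>)"
    using discounted_expansion[of g s] by blast
  obtain K where K: "K \<ge> 0" "\<And>j. \<bar>u j\<bar> \<le> K"
    using bounded_fun_finite[of u] by blast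
  show thesis
  proof (rule that[OF M])
    fix n j assume n: "n \<in> {n. st n = \<pi>}"
    have x_eq: "x n i = g i + \<alpha> n * x n (s i)" for i
      using st[of n i] n unfolding x g_def s_def by simp
    have near: "\<bar>x n i - ((real n + 1) * \<eta> i + u i)\<bar> \<le> C / (real n + 1)" for i
      using exp[of "\<alpha> n" "x n" i, OF \<alpha>(1,2) x_eq] unfolding \<alpha>(3) by (simp add: mult.commute)
    have "C / (real n + 1) \<ge> 0" using near[of j] by linarith
    \<comment> \<open>Multiplication by \<open>\<alpha> n\<close> turns the coefficient n + 1 of the
      slope into n and changes \<open>u l\<close> by \<open>u l / (real n + 1)\<close>, which is
      where \<open>K\<close> enters.\<close>
    have "\<bar>\<alpha> n * x n l - (u l + real n * \<eta> l)\<bar> \<le> C / (real n + 1) + K / (real n + 1)" for l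
    proof -
      have "\<alpha> n * (real n + 1) = real n" "\<alpha> n * u l = u l - u l / (real n + 1)"
        by (auto simp: \<alpha>_def field_simps)
      moreover have "\<alpha> n * (x n l - ((real n + 1) * \<eta> l + u l)) =
          \<alpha> n * x n l - (\<alpha> n * (real n + 1)) * \<eta> l - \<alpha> n * u l"
        by (simp add: algebra_simps)
      ultimately have "\<alpha> n * x n l - (u l + real n * \<eta> l) =
          \<alpha> n * (x n l - ((real n + 1) * \<eta> l + u l)) - u l / (real n + 1)"
        by simp
      also have "\<bar>\<dots>\<bar> \<le> \<alpha> n * \<bar>x n l - ((real n + 1) * \<eta> l + u l)\<bar> + \<bar>u l\<bar> / (real n + 1)"
        using \<alpha>(1)[of n] by (intro order_trans[OF abs_triangle_ineq4]) (simp add: abs_mult)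
      also have "\<dots> \<le> 1 * (C / (real n + 1)) + K / (real n + 1)"
        using \<alpha>(1,2)[of n] near[of l] K(2)[of l]
        by (intro add_mono mult_mono divide_right_mono) auto
      finally show ?thesis by simp
    qed
    then have "\<bar>shapley (\<lambda>l. \<alpha> n * x n l) j - shapley (\<lambda>l. u l + real n * \<eta> l) j\<bar>
        \<le> C / (real n + 1) + K / (real n + 1)"
      by (rule shapley_nonexpansive)
    with near[of j]
    have "\<bar>shapley (\<lambda>l. u l + real n * \<eta> l) j - (u j + (real n + 1) * \<eta> j)\<bar>
        \<le> C / (real n + 1) + (C / (real n + 1) + K / (real n + 1))"
      unfolding x by linarith
    also have "\<dots> = (2 * C + K) / (real n + 1)"
      by (simp add: add_divide_distrib)
    finally show "\<bar>shapley (\<lambda>l. u l + real n * \<eta> l) j - (u j + (real n + 1) * \<eta> j)\<bar>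
        \<le> (2 * C + K) / (real n + 1)" .
  qed
qed

text \<open>Kohlberg's theorem.\<close>

theorem half_line:
  obtains \<eta> u :: "'c \<Rightarrow> real" and \<sigma> \<tau> T where "\<And>i. \<sigma> i \<in> F i" "\<And>j. \<tau> j \<in> E j"
    "\<And>t i l. T \<le> t \<Longrightarrow> l \<in> F i \<Longrightarrow>
      b i l + (u l + t * \<eta> l) \<le> b i (\<sigma> i) + (u (\<sigma> i) + t * \<eta> (\<sigma> i))"
    "\<And>t j i. T \<le> t \<Longrightarrow> i \<in> E j \<Longrightarrow>
      u j + (t + 1) * \<eta> j \<le> a i j + (b i (\<sigma> i) + (u (\<sigma> i) + t * \<eta> (\<sigma> i)))"
    "\<And>t j. T \<le> t \<Longrightarrow> u j + (t + 1) * \<eta> j =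
      a (\<tau> j) j + (b (\<tau> j) (\<sigma> (\<tau> j)) + (u (\<sigma> (\<tau> j)) + t * \<eta> (\<sigma> (\<tau> j))))"
proof -
  obtain \<eta> u C M where M: "infinite M" and approx: "\<And>n j. n \<in> M \<Longrightarrow>
      \<bar>shapley (\<lambda>l. u l + real n * \<eta> l) j - (u j + (real n + 1) * \<eta> j)\<bar> \<le> C / (real n + 1)"
    by (rule approximate_half_line) (rule that)
  define y where "y t l = u l + t * \<eta> l" for t l
  have "\<exists>l\<in>F i. \<forall>\<^sub>F t in at_top. \<forall>k\<in>F i. (b i k + u k) + t * \<eta> k \<le> (b i l + u l) + t * \<eta> l" for i
    using F_nonempty by (intro eventually_affine_max) auto
  then have "\<forall>i. \<exists>l. l \<in> F i \<and>
      (\<forall>\<^sub>F t in at_top. \<forall>k\<in>F i. (b i k + u k) + t * \<eta> k \<le> (b i l + u l) + t * \<eta> l)"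
    by blast
  from choice[OF this] obtain \<sigma> where \<sigma>: "\<And>i. \<sigma> i \<in> F i" and "\<And>i. \<forall>\<^sub>F t in at_top. \<forall>k\<in>F i.
      (b i k + u k) + t * \<eta> k \<le> (b i (\<sigma> i) + u (\<sigma> i)) + t * \<eta> (\<sigma> i)"
    by blast
  then have \<sigma>_opt: "\<forall>\<^sub>F t in at_top. \<forall>i. \<forall>k\<in>F i. b i k + y t k \<le> b i (\<sigma> i) + y t (\<sigma> i)"
    unfolding y_def by (intro eventually_all_finite) (simp add: add.assoc)
  \<comment> \<open>Min's best row maximises the negated payoff, Max's answer being already fixed as
    \<open>\<sigma>\<close>.\<close>
  have "\<exists>i\<in>E j. \<forall>\<^sub>F t in at_top. \<forall>k\<in>E j. - (a k j + b k (\<sigma> k) + u (\<sigma> k)) + t * - \<eta> (\<sigma> k)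
      \<le> - (a i j + b i (\<sigma> i) + u (\<sigma> i)) + t * - \<eta> (\<sigma> i)" for j
    using E_nonempty by (intro eventually_affine_max) auto
  then have "\<forall>j. \<exists>i. i \<in> E j \<and> (\<forall>\<^sub>F t in at_top. \<forall>k\<in>E j.
      - (a k j + b k (\<sigma> k) + u (\<sigma> k)) + t * - \<eta> (\<sigma> k)
      \<le> - (a i j + b i (\<sigma> i) + u (\<sigma> i)) + t * - \<eta> (\<sigma> i))"
    by blast
  from choice[OF this] obtain \<tau> where \<tau>: "\<And>j. \<tau> j \<in> E j" and "\<And>j. \<forall>\<^sub>F t in at_top. \<forall>k\<in>E j.
      - (a k j + b k (\<sigma> k) + u (\<sigma> k)) + t * - \<eta> (\<sigma> k)
      \<le> - (a (\<tau> j) j + b (\<tau> j) (\<sigma> (\<tau> j)) + u (\<sigma> (\<tau> j))) + t * - \<eta> (\<sigma> (\<tau> j))"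
    by blast
  then have \<tau>_opt: "\<forall>\<^sub>F t in at_top. \<forall>j. \<forall>k\<in>E j. a (\<tau> j) j + (b (\<tau> j) (\<sigma> (\<tau> j)) + y t (\<sigma> (\<tau> j)))
      \<le> a k j + (b k (\<sigma> k) + y t (\<sigma> k))"
    unfolding y_def by (intro eventually_all_finite) (simp add: algebra_simps)
  obtain T where T: "\<And>t i k. T \<le> t \<Longrightarrow> k \<in> F i \<Longrightarrow> b i k + y t k \<le> b i (\<sigma> i) + y t (\<sigma> i)"
    "\<And>t j k. T \<le> t \<Longrightarrow> k \<in> E j \<Longrightarrow>
      a (\<tau> j) j + (b (\<tau> j) (\<sigma> (\<tau> j)) + y t (\<sigma> (\<tau> j))) \<le> a k j + (b k (\<sigma> k) + y t (\<sigma> k))"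
    using eventually_conj[OF \<sigma>_opt \<tau>_opt] unfolding eventually_at_top_linorder by blast
  have row: "row_max (y t) i = b i (\<sigma> i) + y t (\<sigma> i)" if "T \<le> t" for t i
    unfolding row_max_def using T(1)[OF that] \<sigma> by (intro Max_eqI) auto
  have shapley: "shapley (y t) j = a (\<tau> j) j + (b (\<tau> j) (\<sigma> (\<tau> j)) + y t (\<sigma> (\<tau> j)))"
    if "T \<le> t" for t j
    unfolding shapley_def row[OF that] using T(2)[OF that] \<tau> by (intro Min_eqI) auto
  have half_line: "y (t + 1) j = a (\<tau> j) j + (b (\<tau> j) (\<sigma> (\<tau> j)) + y t (\<sigma> (\<tau> j)))" for t j
  proof -
    \<comment> \<open>\<open>c + t * d\<close> is the defect of the half-line equation after
      \<open>\<sigma>\<close> and \<open>\<tau>\<close> are inserted; once both coefficients vanish,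
      the equation holds for every \<open>t\<close>.\<close>
    define c where "c = a (\<tau> j) j + b (\<tau> j) (\<sigma> (\<tau> j)) + u (\<sigma> (\<tau> j)) - u j - \<eta> j"
    define d where "d = \<eta> (\<sigma> (\<tau> j)) - \<eta> j"
    \<comment> \<open>Below \<open>T\<close> the chosen moves need not be optimal, so those finitely
      many indices are removed from \<open>M\<close>.\<close>
    have inf: "infinite (M \<inter> {n. T \<le> real n})"
    proof
      assume "finite (M \<inter> {n. T \<le> real n})"
      moreover have "M \<subseteq> (M \<inter> {n. T \<le> real n}) \<union> {..nat \<lceil>T\<rceil>}"
        by (auto simp: real_nat_ceiling_ge) linarith
      ultimately show False
        using M by (meson finite_Un finite_atMost finite_subset)
    qed
    have small: "\<bar>c + real n * d\<bar> \<le> C / (real n + 1)" if "n \<in> M \<inter> {n. T \<le> real n}" for n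
    proof -
      have "shapley (y (real n)) j - (u j + (real n + 1) * \<eta> j) = c + real n * d"
        using that by (simp add: shapley y_def c_def d_def algebra_simps)
      with approx[of n j] that show ?thesis unfolding y_def[abs_def] by simp
    qed
    have "c = 0" "d = 0"
      using affine_zero_if_frequently_small[OF inf small] by blast+
    then show ?thesis by (simp add: c_def d_def y_def algebra_simps)
  qed
  show thesis
    using that[of \<sigma> \<tau> T u \<eta>] \<sigma> \<tau> T half_line unfolding y_def by metis
qed

end

section \<open>Cycle times of topical functions\<close>

lemma ereal_Max_add_right:
  fixes f :: "'a \<Rightarrow> ereal"
  assumes "finite I" "I \<noteq> {}"
  shows "(MAX i\<in>I. f i + c) = (MAX i\<in>I. f i) + c"
  using mono_Max_commute[of "\<lambda>x. x + c" "f ` I"] assms by (simp add: mono_def add_right_mono image_image)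

lemma ereal_Min_add_right:
  fixes f :: "'a \<Rightarrow> ereal"
  assumes "finite I" "I \<noteq> {}"
  shows "(MIN i\<in>I. f i + c) = (MIN i\<in>I. f i) + c"
  using mono_Min_commute[of "\<lambda>x. x + c" "f ` I"] assms by (simp add: mono_def add_right_mono image_image)

lemma mono_Max_image:
  fixes f g :: "'a \<Rightarrow> 'b::linorder"
  assumes "finite I" "I \<noteq> {}" "\<And>i. i \<in> I \<Longrightarrow> f i \<le> g i"
  shows "(MAX i\<in>I. f i) \<le> (MAX i\<in>I. g i)"
proof (intro Max.boundedI)
  fix a assume "a \<in> f ` I"
  then obtain i where "i \<in> I" "a = f i" by blast
  with assms have "a \<le> g i" "g i \<le> (MAX i\<in>I. g i)" by auto
  then show "a \<le> (MAX i\<in>I. g i)" by (rule order_trans)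
qed (use assms in auto)

lemma mono_Min_image:
  fixes f g :: "'a \<Rightarrow> 'b::linorder"
  assumes "finite I" "I \<noteq> {}" "\<And>i. i \<in> I \<Longrightarrow> f i \<le> g i"
  shows "(MIN i\<in>I. f i) \<le> (MIN i\<in>I. g i)"
proof (intro Min.boundedI)
  fix a assume "a \<in> g ` I"
  then obtain i where "i \<in> I" "a = g i" by blast
  with assms have "f i \<le> a" "(MIN i\<in>I. f i) \<le> f i" by auto
  then show "(MIN i\<in>I. f i) \<le> a" by (metis order_trans)
qed (use assms in auto)

definition add_const :: "ereal ^ 'c \<Rightarrow> real \<Rightarrow> ereal ^ 'c" where
  "add_const x c = (\<chi> j. x $ j + ereal c)"

definition topical :: "(ereal ^ 'c \<Rightarrow> ereal ^ 'c) \<Rightarrow> bool" where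
  "topical g \<longleftrightarrow> mono g \<and> (\<forall>x c. g (add_const x c) = add_const (g x) c)"

lemma topicalD:
  assumes "topical g"
  shows "x \<le> y \<Longrightarrow> g x \<le> g y" "g (add_const x c) = add_const (g x) c"
  using assms by (auto simp: topical_def mono_def)

lemma topical_minmax_fun: "topical (minmax_fun (A :: ereal ^ 'c::finite ^ 'r::finite) B)"
  unfolding topical_def mono_def
proof safe
  fix x y :: "ereal ^ 'c" and c assume "x \<le> y"
  then show "minmax_fun A B x \<le> minmax_fun A B y"
    unfolding minmax_fun_def mp_mult_def less_eq_vec_def vec_lambda_beta
    by (intro allI mono_Min_image mono_Max_image add_left_mono) auto
next
  fix x :: "ereal ^ 'c" and c
  show "minmax_fun A B (add_const x c) = add_const (minmax_fun A B x) c"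
    unfolding minmax_fun_def mp_mult_def add_const_def vec_eq_iff
    by (simp add: add.assoc[symmetric] ereal_Max_add_right ereal_Min_add_right)
qed

lemma topical_fun_max_strat: "topical (fun_max_strat (A :: ereal ^ 'c::finite ^ 'r::finite) B \<sigma>)"
  unfolding topical_def mono_def
proof safe
  fix x y :: "ereal ^ 'c" and c assume "x \<le> y"
  then show "fun_max_strat A B \<sigma> x \<le> fun_max_strat A B \<sigma> y"
    unfolding fun_max_strat_def less_eq_vec_def vec_lambda_beta
    by (intro allI mono_Min_image add_left_mono) auto
next
  fix x :: "ereal ^ 'c" and c
  show "fun_max_strat A B \<sigma> (add_const x c) = add_const (fun_max_strat A B \<sigma> x) c"
    unfolding fun_max_strat_def add_const_def vec_eq_iff
    by (simp add: add.assoc[symmetric] ereal_Min_add_right)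
qed

lemma topical_fun_min_strat: "topical (fun_min_strat (A :: ereal ^ 'c::finite ^ 'r::finite) B \<tau>)"
  unfolding topical_def mono_def
proof safe
  fix x y :: "ereal ^ 'c" and c assume "x \<le> y"
  then show "fun_min_strat A B \<tau> x \<le> fun_min_strat A B \<tau> y"
    unfolding fun_min_strat_def less_eq_vec_def vec_lambda_beta
    by (intro allI mono_Max_image add_left_mono) auto
next
  fix x :: "ereal ^ 'c" and c
  show "fun_min_strat A B \<tau> (add_const x c) = add_const (fun_min_strat A B \<tau> x) c"
    unfolding fun_min_strat_def add_const_def vec_eq_iff
    by (simp add: add.assoc[symmetric] ereal_Max_add_right)
qed

definition ray :: "real ^ 'c \<Rightarrow> real ^ 'c \<Rightarrow> real \<Rightarrow> ereal ^ 'c" where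
  "ray u \<eta> t = ereal_vec (u + t *\<^sub>R \<eta>)"

lemma ray_nth [simp]: "ray u \<eta> t $ j = ereal (u $ j + t * \<eta> $ j)"
  by (simp add: ray_def ereal_vec_def)

lemma tendsto_affine_over_n: "(\<lambda>k. (c + real k * d) / real k) \<longlonglongrightarrow> d"
proof -
  have "(\<lambda>k. c / real k + d) \<longlonglongrightarrow> 0 + d"
    by (intro tendsto_add tendsto_const lim_const_over_n)
  moreover have "\<forall>\<^sub>F k in sequentially. c / real k + d = (c + real k * d) / real k"
    using eventually_gt_at_top[of "0::nat"] by eventually_elim (simp add: field_simps)
  ultimately show ?thesis by (simp add: tendsto_cong)
qed

text \<open>Any finite start is within \<open>K\<close> of the point of the ray at \<open>T\<close>.
  Monotonicity and homogeneity keep the iterates within \<open>K\<close> of the moving point, and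
  \<open>K\<close> disappears after division by \<open>k\<close>.\<close>

lemma has_cycle_time_if_ray:
  fixes g :: "ereal ^ 'c::finite \<Rightarrow> ereal ^ 'c"
  assumes g: "topical g" and ray: "\<And>t. T \<le> t \<Longrightarrow> g (ray u \<eta> t) = ray u \<eta> (t + 1)"
  shows "has_cycle_time g \<eta>"
  unfolding has_cycle_time_def
proof safe
  fix x :: "real ^ 'c" and j
  obtain K where K: "\<And>j. \<bar>x $ j - (u $ j + T * \<eta> $ j)\<bar> \<le> K"
    using bounded_fun_finite[of "\<lambda>j. x $ j - (u $ j + T * \<eta> $ j)"] by metis
  have step: "g (add_const (ray u \<eta> (T + real k)) c) = add_const (ray u \<eta> (T + real (Suc k))) c" for k c
    by (simp add: topicalD(2)[OF g] ray ac_simps)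
  have "add_const (ray u \<eta> (T + real k)) (- K) \<le> (g ^^ k) (ereal_vec x) \<and>
      (g ^^ k) (ereal_vec x) \<le> add_const (ray u \<eta> (T + real k)) K" for k
  proof (induction k)
    case 0
    have "(u $ j + T * \<eta> $ j) - K \<le> x $ j \<and> x $ j \<le> (u $ j + T * \<eta> $ j) + K" for j
      using K[of j] by (auto simp: abs_le_iff algebra_simps)
    then show ?case by (simp add: less_eq_vec_def add_const_def ereal_vec_def)
  next
    case (Suc k)
    then show ?case
      by (simp only: funpow.simps o_apply step[symmetric]) (blast intro: topicalD(1)[OF g])
  qed
  then have bounds: "ereal (u $ j + (T + real k) * \<eta> $ j - K) \<le> (g ^^ k) (ereal_vec x) $ j"
    "(g ^^ k) (ereal_vec x) $ j \<le> ereal (u $ j + (T + real k) * \<eta> $ j + K)" for k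
    by (simp_all add: less_eq_vec_def add_const_def)
  have lim: "(\<lambda>k. ereal ((u $ j + (T + real k) * \<eta> $ j + c) / real k)) \<longlonglongrightarrow> ereal (\<eta> $ j)" for c
    using tendsto_affine_over_n[of "u $ j + T * \<eta> $ j + c" "\<eta> $ j"]
    by (simp add: algebra_simps)
  have divide: "a \<le> b \<Longrightarrow> a / ereal (real k) \<le> b / ereal (real k)" if "k > 0" for a b k
    using that by (intro ereal_divide_right_mono) auto
  show "(\<lambda>k. (g ^^ k) (ereal_vec x) $ j / ereal (real k)) \<longlonglongrightarrow> ereal (\<eta> $ j)"
  proof (rule tendsto_sandwich[OF _ _ lim lim])
    show "\<forall>\<^sub>F k in sequentially. ereal ((u $ j + (T + real k) * \<eta> $ j + - K) / real k)
        \<le> (g ^^ k) (ereal_vec x) $ j / ereal (real k)"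
      using eventually_gt_at_top[of 0] by eventually_elim (use divide[OF _ bounds(1)] in auto)
    show "\<forall>\<^sub>F k in sequentially. (g ^^ k) (ereal_vec x) $ j / ereal (real k)
        \<le> ereal ((u $ j + (T + real k) * \<eta> $ j + K) / real k)"
      using eventually_gt_at_top[of 0] by eventually_elim (use divide[OF _ bounds(2)] in auto)
  qed
qed

lemma cycle_time_eq:
  assumes "has_cycle_time g v"
  shows "cycle_time g = v"
  unfolding cycle_time_def
proof (rule the_equality)
  show "has_cycle_time g v" by fact
  fix w assume "has_cycle_time g w"
  with assms have "ereal (w $ j) = ereal (v $ j)" for j
    unfolding has_cycle_time_def using LIMSEQ_unique by blast
  then show "w = v" by (simp add: vec_eq_iff)
qed

lemma cycle_time_mono:
  assumes "has_cycle_time g v" "has_cycle_time h w" "mono h" "\<And>x. g x \<le> h x"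
  shows "v $ j \<le> w $ j"
proof -
  have "(g ^^ k) x \<le> (h ^^ k) x" for k x
  proof (induction k)
    case (Suc k)
    have "g ((g ^^ k) x) \<le> h ((g ^^ k) x)" by (rule assms)
    also have "\<dots> \<le> h ((h ^^ k) x)" using assms(3) Suc by (rule monoD)
    finally show ?case by simp
  qed simp
  then have "(g ^^ k) (ereal_vec 0) $ j / ereal (real k) \<le> (h ^^ k) (ereal_vec 0) $ j / ereal (real k)" for k
    by (cases "k = 0") (auto simp: less_eq_vec_def intro!: ereal_divide_right_mono)
  moreover have "(\<lambda>k. (g ^^ k) (ereal_vec 0) $ j / ereal (real k)) \<longlonglongrightarrow> ereal (v $ j)"
    "(\<lambda>k. (h ^^ k) (ereal_vec 0) $ j / ereal (real k)) \<longlonglongrightarrow> ereal (w $ j)"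
    using assms unfolding has_cycle_time_def by blast+
  ultimately have "ereal (v $ j) \<le> ereal (w $ j)"
    by (intro LIMSEQ_le) auto
  then show ?thesis by simp
qed

text \<open>The iterates of a point that \<open>g\<close> does not decrease stay above it, and the
  point divided by \<open>k\<close> tends to 0.\<close>

lemma cycle_time_nonneg:
  assumes "has_cycle_time g v" "mono g" "ereal_vec x \<le> g (ereal_vec x)"
  shows "v $ j \<ge> 0"
proof -
  have "ereal_vec x \<le> (g ^^ k) (ereal_vec x)" for k
  proof (induction k)
    case (Suc k)
    have "g (ereal_vec x) \<le> g ((g ^^ k) (ereal_vec x))" using assms(2) Suc by (rule monoD)
    with assms(3) show ?case by (auto intro: order_trans)
  qed simp
  then have "ereal (x $ j) / ereal (real k) \<le> (g ^^ k) (ereal_vec x) $ j / ereal (real k)" if "k > 0" for k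
    using that by (intro ereal_divide_right_mono) (auto simp: less_eq_vec_def ereal_vec_def)
  then have "\<forall>\<^sub>F k in sequentially. ereal (x $ j / real k) \<le> (g ^^ k) (ereal_vec x) $ j / ereal (real k)"
    by (auto intro!: eventually_mono[OF eventually_gt_at_top[of "0::nat"]])
  moreover have "(\<lambda>k. ereal (x $ j / real k)) \<longlonglongrightarrow> ereal 0"
    using lim_const_over_n[of "x $ j"] by simp
  moreover have "(\<lambda>k. (g ^^ k) (ereal_vec x) $ j / ereal (real k)) \<longlonglongrightarrow> ereal (v $ j)"
    using assms(1) unfolding has_cycle_time_def by blast
  ultimately have "ereal 0 \<le> ereal (v $ j)"
    by (intro tendsto_le[OF sequentially_bot])
  then show ?thesis by simp
qed

section \<open>Strategies along an invariant half-line\<close>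

text \<open>One half of the half-line equation: a guarantee for \<open>\<sigma>\<close> against all
  rows. A row that Min cannot choose at \<open>j\<close> makes the right-hand side
  \<open>\<infinity>\<close> and so imposes nothing.\<close>

definition max_ray :: "ereal ^ 'c ^ 'r \<Rightarrow> ereal ^ 'c ^ 'r \<Rightarrow> ('r \<Rightarrow> 'c) \<Rightarrow> real ^ 'c \<Rightarrow> real ^ 'c \<Rightarrow> real \<Rightarrow> bool" where
  "max_ray A B \<sigma> u \<eta> T \<longleftrightarrow> (\<forall>t\<ge>T. \<forall>i j.
     ray u \<eta> (t + 1) $ j \<le> - (A $ i $ j) + (B $ i $ \<sigma> i + ray u \<eta> t $ \<sigma> i))"

text \<open>The guarantee for \<open>\<tau>\<close>; when \<open>\<tau>\<close> is a strategy of
  Min, a column that Max cannot choose makes the left-hand side \<open>-\<infinity>\<close>.\<close>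

definition min_ray :: "ereal ^ 'c ^ 'r \<Rightarrow> ereal ^ 'c ^ 'r \<Rightarrow> ('c \<Rightarrow> 'r) \<Rightarrow> real ^ 'c \<Rightarrow> real ^ 'c \<Rightarrow> real \<Rightarrow> bool" where
  "min_ray A B \<tau> u \<eta> T \<longleftrightarrow> (\<forall>t\<ge>T. \<forall>j l.
     - (A $ \<tau> j $ j) + (B $ \<tau> j $ l + ray u \<eta> t $ l) \<le> ray u \<eta> (t + 1) $ j)"

locale mp_game =
  fixes A B :: "ereal ^ 'c::finite ^ 'r::finite"
  assumes A_not_PInf: "A $ i $ j \<noteq> \<infinity>" and B_not_PInf: "B $ i $ j \<noteq> \<infinity>"
    and A_column: "\<exists>i. A $ i $ j \<noteq> -\<infinity>" and B_row: "\<exists>j. B $ i $ j \<noteq> -\<infinity>"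
begin

lemma saddle_ray:
  obtains \<sigma> \<tau> u \<eta> T where "\<sigma> \<in> max_strategies B" "\<tau> \<in> min_strategies A"
    "max_ray A B \<sigma> u \<eta> T" "min_ray A B \<tau> u \<eta> T"
proof -
  define E where "E j = {i. A $ i $ j \<noteq> -\<infinity>}" for j
  define F where "F i = {l. B $ i $ l \<noteq> -\<infinity>}" for i
  define a where "a i j = - real_of_ereal (A $ i $ j)" for i j
  define b where "b i l = real_of_ereal (B $ i $ l)" for i l
  have a: "- (A $ i $ j) = ereal (a i j)" if "i \<in> E j" for i j
    using that A_not_PInf[of i j] unfolding E_def a_def by (cases "A $ i $ j") auto
  have not_E: "- (A $ i $ j) = \<infinity>" if "i \<notin> E j" for i j
    using that unfolding E_def by simp
  have b: "B $ i $ l = ereal (b i l)" if "l \<in> F i" for i l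
    using that B_not_PInf[of i l] unfolding F_def b_def by (cases "B $ i $ l") auto
  have not_F: "B $ i $ l = -\<infinity>" if "l \<notin> F i" for i l
    using that unfolding F_def by simp
  interpret real_game E F a b
    using A_column B_row by unfold_locales (auto simp: E_def F_def)
  obtain \<eta> u \<sigma> \<tau> T where \<sigma>: "\<And>i. \<sigma> i \<in> F i" and \<tau>: "\<And>j. \<tau> j \<in> E j"
    and \<sigma>_max: "\<And>t i l. T \<le> t \<Longrightarrow> l \<in> F i \<Longrightarrow>
      b i l + (u l + t * \<eta> l) \<le> b i (\<sigma> i) + (u (\<sigma> i) + t * \<eta> (\<sigma> i))"
    and le: "\<And>t j i. T \<le> t \<Longrightarrow> i \<in> E j \<Longrightarrow>
      u j + (t + 1) * \<eta> j \<le> a i j + (b i (\<sigma> i) + (u (\<sigma> i) + t * \<eta> (\<sigma> i)))"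
    and eq: "\<And>t j. T \<le> t \<Longrightarrow> u j + (t + 1) * \<eta> j =
      a (\<tau> j) j + (b (\<tau> j) (\<sigma> (\<tau> j)) + (u (\<sigma> (\<tau> j)) + t * \<eta> (\<sigma> (\<tau> j))))"
    by (rule half_line) (rule that)
  show thesis
  proof (rule that)
    show "\<sigma> \<in> max_strategies B"
      using \<sigma> by (simp add: max_strategies_def F_def)
    show "\<tau> \<in> min_strategies A"
      using \<tau> by (simp add: min_strategies_def E_def)
    show "max_ray A B \<sigma> (\<chi> j. u j) (\<chi> j. \<eta> j) T"
      unfolding max_ray_def
    proof (intro allI impI)
      fix t i j assume "T \<le> t"
      then show "ray (\<chi> j. u j) (\<chi> j. \<eta> j) (t + 1) $ j
          \<le> - (A $ i $ j) + (B $ i $ \<sigma> i + ray (\<chi> j. u j) (\<chi> j. \<eta> j) t $ \<sigma> i)"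
        using le[of t i j] by (cases "i \<in> E j") (auto simp: a not_E b[OF \<sigma>])
    qed
    show "min_ray A B \<tau> (\<chi> j. u j) (\<chi> j. \<eta> j) T"
      unfolding min_ray_def
    proof (intro allI impI)
      fix t j l assume t: "T \<le> t"
      show "- (A $ \<tau> j $ j) + (B $ \<tau> j $ l + ray (\<chi> j. u j) (\<chi> j. \<eta> j) t $ l)
          \<le> ray (\<chi> j. u j) (\<chi> j. \<eta> j) (t + 1) $ j"
        using \<sigma>_max[OF t, of l "\<tau> j"] unfolding a[OF \<tau>]
        by (cases "l \<in> F (\<tau> j)") (auto simp: eq[OF t] b not_F)
    qed
  qed
qed

end

text \<open>The two guarantees pinch: the row of \<open>\<tau>\<close> bounds the minimum from
  above, the column of \<open>\<sigma>\<close> bounds every maximum from below.\<close>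

lemma minmax_fun_ray:
  fixes A B :: "ereal ^ 'c::finite ^ 'r::finite"
  assumes "max_ray A B \<sigma> u \<eta> T" "min_ray A B \<tau> u \<eta> T" "T \<le> t"
  shows "minmax_fun A B (ray u \<eta> t) = ray u \<eta> (t + 1)"
proof (intro antisym)
  show "minmax_fun A B (ray u \<eta> t) \<le> ray u \<eta> (t + 1)"
    unfolding less_eq_vec_def
  proof
    fix j
    have "minmax_fun A B (ray u \<eta> t) $ j \<le> - (A $ \<tau> j $ j) + mp_mult B (ray u \<eta> t) $ \<tau> j"
      unfolding minmax_fun_def by simp
    also have "mp_mult B (ray u \<eta> t) $ \<tau> j \<in> range (\<lambda>l. B $ \<tau> j $ l + ray u \<eta> t $ l)"
      unfolding mp_mult_def vec_lambda_beta by (intro Max_in) auto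
    then have "- (A $ \<tau> j $ j) + mp_mult B (ray u \<eta> t) $ \<tau> j \<le> ray u \<eta> (t + 1) $ j"
      using assms(2,3) unfolding min_ray_def by auto
    finally show "minmax_fun A B (ray u \<eta> t) $ j \<le> ray u \<eta> (t + 1) $ j" .
  qed
  show "ray u \<eta> (t + 1) \<le> minmax_fun A B (ray u \<eta> t)"
    unfolding less_eq_vec_def minmax_fun_def vec_lambda_beta
  proof (intro allI Min.boundedI)
    fix j x assume "x \<in> range (\<lambda>i. - (A $ i $ j) + mp_mult B (ray u \<eta> t) $ i)"
    then obtain i where x: "x = - (A $ i $ j) + mp_mult B (ray u \<eta> t) $ i" by blast
    have "ray u \<eta> (t + 1) $ j \<le> - (A $ i $ j) + (B $ i $ \<sigma> i + ray u \<eta> t $ \<sigma> i)"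
      using assms unfolding max_ray_def by blast
    also have "\<dots> \<le> x"
      unfolding x mp_mult_def vec_lambda_beta by (intro add_left_mono Max_ge) auto
    finally show "ray u \<eta> (t + 1) $ j \<le> x" .
  qed auto
qed

text \<open>With Max bound to \<open>\<sigma>\<close>, a row of Min has to be good only against the
  column that \<open>\<sigma>\<close> picks there; the last hypothesis takes the place of
  \<open>min_ray\<close>.\<close>

lemma fun_max_strat_ray:
  fixes A B :: "ereal ^ 'c::finite ^ 'r::finite"
  assumes "max_ray A B \<sigma> u \<eta> T" "T \<le> t"
    and "\<And>j. - (A $ \<tau> j $ j) + (B $ \<tau> j $ \<sigma> (\<tau> j) + ray u \<eta> t $ \<sigma> (\<tau> j)) \<le> ray u \<eta> (t + 1) $ j"
  shows "fun_max_strat A B \<sigma> (ray u \<eta> t) = ray u \<eta> (t + 1)"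
proof (intro antisym)
  show "fun_max_strat A B \<sigma> (ray u \<eta> t) \<le> ray u \<eta> (t + 1)"
    unfolding less_eq_vec_def
  proof
    fix j
    have "fun_max_strat A B \<sigma> (ray u \<eta> t) $ j
        \<le> - (A $ \<tau> j $ j) + B $ \<tau> j $ \<sigma> (\<tau> j) + ray u \<eta> t $ \<sigma> (\<tau> j)"
      unfolding fun_max_strat_def vec_lambda_beta by (rule Min_le) auto
    also have "\<dots> \<le> ray u \<eta> (t + 1) $ j"
      using assms(3)[of j] unfolding add.assoc .
    finally show "fun_max_strat A B \<sigma> (ray u \<eta> t) $ j \<le> ray u \<eta> (t + 1) $ j" .
  qed
  show "ray u \<eta> (t + 1) \<le> fun_max_strat A B \<sigma> (ray u \<eta> t)"
    unfolding less_eq_vec_def fun_max_strat_def vec_lambda_beta add.assoc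
    using assms(1,2) unfolding max_ray_def by (intro allI Min.boundedI) (auto simp del: ray_nth)
qed

lemma fun_min_strat_ray:
  fixes A B :: "ereal ^ 'c::finite ^ 'r::finite"
  assumes "min_ray A B \<tau> u \<eta> T" "T \<le> t"
    and "\<And>j. ray u \<eta> (t + 1) $ j \<le> - (A $ \<tau> j $ j) + (B $ \<tau> j $ \<sigma> (\<tau> j) + ray u \<eta> t $ \<sigma> (\<tau> j))"
  shows "fun_min_strat A B \<tau> (ray u \<eta> t) = ray u \<eta> (t + 1)"
proof (intro antisym)
  show "fun_min_strat A B \<tau> (ray u \<eta> t) \<le> ray u \<eta> (t + 1)"
    unfolding less_eq_vec_def
  proof
    fix j
    have "(MAX l. B $ \<tau> j $ l + ray u \<eta> t $ l) \<in> range (\<lambda>l. B $ \<tau> j $ l + ray u \<eta> t $ l)"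
      by (intro Max_in) auto
    then obtain l where l: "(MAX l. B $ \<tau> j $ l + ray u \<eta> t $ l) = B $ \<tau> j $ l + ray u \<eta> t $ l"
      by blast
    show "fun_min_strat A B \<tau> (ray u \<eta> t) $ j \<le> ray u \<eta> (t + 1) $ j"
      using assms(1,2) unfolding min_ray_def fun_min_strat_def vec_lambda_beta l by blast
  qed
  show "ray u \<eta> (t + 1) \<le> fun_min_strat A B \<tau> (ray u \<eta> t)"
    unfolding less_eq_vec_def
  proof
    fix j
    note assms(3)[of j]
    also have "- (A $ \<tau> j $ j) + (B $ \<tau> j $ \<sigma> (\<tau> j) + ray u \<eta> t $ \<sigma> (\<tau> j))
        \<le> fun_min_strat A B \<tau> (ray u \<eta> t) $ j"
      unfolding fun_min_strat_def vec_lambda_beta by (intro add_left_mono Max_ge) auto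
    finally show "ray u \<eta> (t + 1) $ j \<le> fun_min_strat A B \<tau> (ray u \<eta> t) $ j" .
  qed
qed

lemma fun_max_strat_le_minmax_fun:
  fixes A B :: "ereal ^ 'c::finite ^ 'r::finite"
  shows "fun_max_strat A B \<sigma> x \<le> minmax_fun A B x"
  unfolding less_eq_vec_def fun_max_strat_def minmax_fun_def mp_mult_def vec_lambda_beta add.assoc
  by (intro allI mono_Min_image add_left_mono Max_ge) auto

lemma minmax_fun_le_fun_min_strat:
  fixes A B :: "ereal ^ 'c::finite ^ 'r::finite"
  shows "minmax_fun A B x \<le> fun_min_strat A B \<tau> x"
  unfolding less_eq_vec_def fun_min_strat_def minmax_fun_def mp_mult_def vec_lambda_beta
  by (intro allI Min_le) auto

context mp_game
begin

text \<open>Overwriting with \<open>-\<infinity>\<close> every entry of \<open>B\<close> that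
  \<open>\<sigma>\<close> does not pick leaves Max with \<open>\<sigma>\<close> alone; a saddle of
  this smaller game contains an optimal answer of Min to \<open>\<sigma>\<close>.\<close>

lemma one_player_max_ray:
  assumes \<sigma>: "\<sigma> \<in> max_strategies B"
  obtains \<tau> u \<eta> T where "\<tau> \<in> min_strategies A" "max_ray A B \<sigma> u \<eta> T"
    "\<And>t j. T \<le> t \<Longrightarrow>
      - (A $ \<tau> j $ j) + (B $ \<tau> j $ \<sigma> (\<tau> j) + ray u \<eta> t $ \<sigma> (\<tau> j)) \<le> ray u \<eta> (t + 1) $ j"
proof -
  define B' :: "ereal ^ 'c ^ 'r" where "B' = (\<chi> i l. if l = \<sigma> i then B $ i $ l else -\<infinity>)"
  have B': "B' $ i $ l = (if l = \<sigma> i then B $ i $ l else -\<infinity>)" for i l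
    by (simp add: B'_def)
  interpret restricted: mp_game A B'
    using A_not_PInf B_not_PInf A_column \<sigma> by unfold_locales (auto simp: B' max_strategies_def)
  obtain \<sigma>' \<tau> u \<eta> T where *: "\<sigma>' \<in> max_strategies B'" "\<tau> \<in> min_strategies A"
    "max_ray A B' \<sigma>' u \<eta> T" "min_ray A B' \<tau> u \<eta> T"
    by (rule restricted.saddle_ray)
  have "\<sigma>' = \<sigma>"
    using *(1) by (auto simp: max_strategies_def B' split: if_splits)
  with *(3) have "max_ray A B \<sigma> u \<eta> T"
    by (simp add: max_ray_def B')
  moreover have "- (A $ \<tau> j $ j) + (B $ \<tau> j $ \<sigma> (\<tau> j) + ray u \<eta> t $ \<sigma> (\<tau> j)) \<le> ray u \<eta> (t + 1) $ j"
    if "T \<le> t" for t j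
    using *(4) that B'[of "\<tau> j" "\<sigma> (\<tau> j)"] unfolding min_ray_def by metis
  ultimately show thesis
    using *(2) by (intro that)
qed

text \<open>The same restriction applied to \<open>A\<close> leaves Min with \<open>\<tau>\<close>
  alone.\<close>

lemma one_player_min_ray:
  assumes \<tau>: "\<tau> \<in> min_strategies A"
  obtains \<sigma> u \<eta> T where "\<sigma> \<in> max_strategies B" "min_ray A B \<tau> u \<eta> T"
    "\<And>t j. T \<le> t \<Longrightarrow>
      ray u \<eta> (t + 1) $ j \<le> - (A $ \<tau> j $ j) + (B $ \<tau> j $ \<sigma> (\<tau> j) + ray u \<eta> t $ \<sigma> (\<tau> j))"
proof -
  define A' :: "ereal ^ 'c ^ 'r" where "A' = (\<chi> i j. if i = \<tau> j then A $ i $ j else -\<infinity>)"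
  have A': "A' $ i $ j = (if i = \<tau> j then A $ i $ j else -\<infinity>)" for i j
    by (simp add: A'_def)
  interpret restricted: mp_game A' B
    using A_not_PInf B_not_PInf B_row \<tau> by unfold_locales (auto simp: A' min_strategies_def)
  obtain \<sigma> \<tau>' u \<eta> T where *: "\<sigma> \<in> max_strategies B" "\<tau>' \<in> min_strategies A'"
    "max_ray A' B \<sigma> u \<eta> T" "min_ray A' B \<tau>' u \<eta> T"
    by (rule restricted.saddle_ray)
  have "\<tau>' = \<tau>"
    using *(2) by (auto simp: min_strategies_def A' split: if_splits)
  with *(4) have "min_ray A B \<tau> u \<eta> T"
    by (simp add: min_ray_def A')
  moreover have "ray u \<eta> (t + 1) $ j \<le> - (A $ \<tau> j $ j) + (B $ \<tau> j $ \<sigma> (\<tau> j) + ray u \<eta> t $ \<sigma> (\<tau> j))"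
    if "T \<le> t" for t j
    using *(3) that A'[of "\<tau> j" j] unfolding max_ray_def by metis
  ultimately show thesis
    using *(1) by (intro that)
qed

lemma has_cycle_time_fun_max_strat:
  assumes "\<sigma> \<in> max_strategies B"
  shows "has_cycle_time (fun_max_strat A B \<sigma>) (cycle_time (fun_max_strat A B \<sigma>))"
proof -
  obtain \<tau> u \<eta> T where *: "max_ray A B \<sigma> u \<eta> T" "\<And>t j. T \<le> t \<Longrightarrow>
      - (A $ \<tau> j $ j) + (B $ \<tau> j $ \<sigma> (\<tau> j) + ray u \<eta> t $ \<sigma> (\<tau> j)) \<le> ray u \<eta> (t + 1) $ j"
    by (rule one_player_max_ray[OF assms]) (rule that)
  then have "has_cycle_time (fun_max_strat A B \<sigma>) \<eta>"
    by (intro has_cycle_time_if_ray topical_fun_max_strat fun_max_strat_ray)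
  then show ?thesis by (simp add: cycle_time_eq)
qed

lemma has_cycle_time_fun_min_strat:
  assumes "\<tau> \<in> min_strategies A"
  shows "has_cycle_time (fun_min_strat A B \<tau>) (cycle_time (fun_min_strat A B \<tau>))"
proof -
  obtain \<sigma> u \<eta> T where *: "min_ray A B \<tau> u \<eta> T" "\<And>t j. T \<le> t \<Longrightarrow>
      ray u \<eta> (t + 1) $ j \<le> - (A $ \<tau> j $ j) + (B $ \<tau> j $ \<sigma> (\<tau> j) + ray u \<eta> t $ \<sigma> (\<tau> j))"
    by (rule one_player_min_ray[OF assms]) (rule that)
  then have "has_cycle_time (fun_min_strat A B \<tau>) \<eta>"
    by (intro has_cycle_time_if_ray topical_fun_min_strat fun_min_strat_ray)
  then show ?thesis by (simp add: cycle_time_eq)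
qed

lemma saddle_ray_cycle_times:
  assumes "max_ray A B \<sigma> u \<eta> T" "min_ray A B \<tau> u \<eta> T"
  shows "has_cycle_time (minmax_fun A B) \<eta>" "has_cycle_time (fun_max_strat A B \<sigma>) \<eta>"
    "has_cycle_time (fun_min_strat A B \<tau>) \<eta>"
proof -
  show "has_cycle_time (minmax_fun A B) \<eta>"
    using minmax_fun_ray[OF assms] by (intro has_cycle_time_if_ray topical_minmax_fun)
  show "has_cycle_time (fun_max_strat A B \<sigma>) \<eta>"
    using assms
    by (intro has_cycle_time_if_ray topical_fun_max_strat fun_max_strat_ray[where \<tau> = \<tau>]) (auto simp only: min_ray_def)
  show "has_cycle_time (fun_min_strat A B \<tau>) \<eta>"
    using assms
    by (intro has_cycle_time_if_ray topical_fun_min_strat fun_min_strat_ray[where \<sigma> = \<sigma>]) (auto simp only: max_ray_def)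
qed

text \<open>The min-max function lies pointwise above every \<open>fun_max_strat\<close> and below
  every \<open>fun_min_strat\<close>, which gives the weak inequalities. The saddle pair attains
  both, in all components at once, because its two functions and the min-max function move along the
  same ray.\<close>

lemma duality:
  shows "(MAX \<sigma>\<in>max_strategies B. cycle_time (fun_max_strat A B \<sigma>) $ j) = cycle_time (minmax_fun A B) $ j"
    and "(MIN \<tau>\<in>min_strategies A. cycle_time (fun_min_strat A B \<tau>) $ j) = cycle_time (minmax_fun A B) $ j"
proof -
  obtain \<sigma> \<tau> u \<eta> T where \<sigma>\<tau>: "\<sigma> \<in> max_strategies B" "\<tau> \<in> min_strategies A"
    and "max_ray A B \<sigma> u \<eta> T" "min_ray A B \<tau> u \<eta> T"
    by (rule saddle_ray)
  note \<eta> = saddle_ray_cycle_times[OF this(3,4)]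
  note mono = topical_minmax_fun[unfolded topical_def, THEN conjunct1]
    topical_fun_min_strat[unfolded topical_def, THEN conjunct1]
  show "(MAX \<sigma>\<in>max_strategies B. cycle_time (fun_max_strat A B \<sigma>) $ j) = cycle_time (minmax_fun A B) $ j"
  proof (rule Max_eqI)
    show "cycle_time (minmax_fun A B) $ j \<in> (\<lambda>\<sigma>. cycle_time (fun_max_strat A B \<sigma>) $ j) ` max_strategies B"
      using \<sigma>\<tau>(1) by (intro image_eqI[of _ _ \<sigma>]) (simp_all add: \<eta>[THEN cycle_time_eq])
  next
    fix y assume "y \<in> (\<lambda>\<sigma>. cycle_time (fun_max_strat A B \<sigma>) $ j) ` max_strategies B"
    then show "y \<le> cycle_time (minmax_fun A B) $ j"
      using has_cycle_time_fun_max_strat \<eta>(1) mono(1) fun_max_strat_le_minmax_fun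
      by (auto simp: cycle_time_eq[OF \<eta>(1)] intro!: cycle_time_mono)
  qed simp
  show "(MIN \<tau>\<in>min_strategies A. cycle_time (fun_min_strat A B \<tau>) $ j) = cycle_time (minmax_fun A B) $ j"
  proof (rule Min_eqI)
    show "cycle_time (minmax_fun A B) $ j \<in> (\<lambda>\<tau>. cycle_time (fun_min_strat A B \<tau>) $ j) ` min_strategies A"
      using \<sigma>\<tau>(2) by (intro image_eqI[of _ _ \<tau>]) (simp_all add: \<eta>[THEN cycle_time_eq])
  next
    fix y assume "y \<in> (\<lambda>\<tau>. cycle_time (fun_min_strat A B \<tau>) $ j) ` min_strategies A"
    then show "cycle_time (minmax_fun A B) $ j \<le> y"
      using has_cycle_time_fun_min_strat \<eta>(1) mono(2) minmax_fun_le_fun_min_strat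
      by (auto simp: cycle_time_eq[OF \<eta>(1)] intro!: cycle_time_mono)
  qed simp
qed

end

section \<open>Value of the game\<close>

lemma min_node_at_0 [simp]: "min_node_at \<phi> \<psi> j 0 = j"
  by (simp add: min_node_at_def)

lemma min_node_at_positional_max:
  "min_node_at (positional_max \<sigma>) \<psi> j (Suc t) = \<sigma> (max_node_at (positional_max \<sigma>) \<psi> j t)"
  by (simp add: min_node_at_def max_node_at_def positional_max_def Let_def split: prod.splits)

lemma max_node_at_positional_min:
  "max_node_at \<phi> (positional_min \<tau>) j t = \<tau> (min_node_at \<phi> (positional_min \<tau>) j t)"
  by (simp add: min_node_at_def max_node_at_def positional_min_def Let_def split: prod.splits)

lemma positional_max_policy: "\<sigma> \<in> max_strategies B \<Longrightarrow> positional_max \<sigma> \<in> max_policies B"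
  by (simp add: max_strategies_def max_policies_def positional_max_def)

lemma positional_min_policy: "\<tau> \<in> min_strategies A \<Longrightarrow> positional_min \<tau> \<in> min_policies A"
  by (simp add: min_strategies_def min_policies_def positional_min_def)

lemma ereal_divide_nat_mono:
  assumes "n > 0"
  shows "ereal a \<le> x \<Longrightarrow> ereal (a / real n) \<le> x / ereal (real n)"
    and "x \<le> ereal a \<Longrightarrow> x / ereal (real n) \<le> ereal (a / real n)"
  using assms by (cases x; simp add: divide_right_mono)+

text \<open>The ray is read backwards: its parameter is \<open>T\<close> plus the number of turns
  still to be played. The payoff of each turn makes up for one step down the ray, and the final
  point contributes only a bounded term.\<close>

lemma max_secures_if_max_ray:
  fixes A B :: "ereal ^ 'c::finite ^ 'r::finite"
  assumes "max_ray A B \<sigma> u \<eta> T"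
  shows "max_secures A B (positional_max \<sigma>) j (\<eta> $ j)"
  unfolding max_secures_def
proof
  fix \<psi>
  let ?c = "min_node_at (positional_max \<sigma>) \<psi> j" and ?r = "max_node_at (positional_max \<sigma>) \<psi> j"
  let ?S = "\<lambda>N. \<Sum>t<N. - (A $ ?r t $ ?c t) + B $ ?r t $ ?c (Suc t)"
  obtain K where K: "\<And>i. \<bar>u $ i + T * \<eta> $ i\<bar> \<le> K"
    using bounded_fun_finite[of "\<lambda>i. u $ i + T * \<eta> $ i"] by metis
  \<comment> \<open>\<open>s\<close> is kept general because splitting off the last turn calls for
    the induction hypothesis at \<open>s + 1\<close>.\<close>
  have "ray u \<eta> (s + real N) $ j \<le> ?S N + ray u \<eta> s $ ?c N" if "T \<le> s" for s N
    using that
  proof (induction N arbitrary: s)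
    case (Suc N)
    have "ray u \<eta> (s + real (Suc N)) $ j = ray u \<eta> ((s + 1) + real N) $ j"
      by (simp add: add.assoc)
    also have "\<dots> \<le> ?S N + ray u \<eta> (s + 1) $ ?c N"
      using Suc.prems by (intro Suc.IH) simp
    also have "ray u \<eta> (s + 1) $ ?c N \<le> - (A $ ?r N $ ?c N) + (B $ ?r N $ ?c (Suc N) + ray u \<eta> s $ ?c (Suc N))"
      using assms Suc.prems unfolding max_ray_def min_node_at_positional_max by blast
    finally show ?case
      by (simp add: add_left_mono add.assoc del: ray_nth)
  qed simp
  then have bound: "ray u \<eta> (T + real N) $ j \<le> ?S N + ray u \<eta> T $ ?c N" for N by simp
  have "ereal (u $ j + T * \<eta> $ j - K + real N * \<eta> $ j) \<le> ?S N" for N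
    using bound[of N] K[of "?c N"] by (cases "?S N") (auto simp: algebra_simps)
  then have le: "\<forall>\<^sub>F N in sequentially. ereal ((u $ j + T * \<eta> $ j - K + real N * \<eta> $ j) / real N)
      \<le> mean_payoff A B (positional_max \<sigma>) \<psi> j N"
    unfolding mean_payoff_def
    by (intro eventually_mono[OF eventually_gt_at_top[of 0]] ereal_divide_nat_mono(1))
  have "(\<lambda>N. ereal ((u $ j + T * \<eta> $ j - K + real N * \<eta> $ j) / real N)) \<longlonglongrightarrow> ereal (\<eta> $ j)"
    using tendsto_affine_over_n by simp
  from lim_imp_Liminf[OF sequentially_bot this] Liminf_mono[OF le]
  show "ereal (\<eta> $ j) \<le> liminf (mean_payoff A B (positional_max \<sigma>) \<psi> j)" by simp
qed

lemma min_secures_if_min_ray: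
  fixes A B :: "ereal ^ 'c::finite ^ 'r::finite"
  assumes "min_ray A B \<tau> u \<eta> T"
  shows "min_secures A B (positional_min \<tau>) j (\<eta> $ j)"
  unfolding min_secures_def
proof
  fix \<phi>
  let ?c = "min_node_at \<phi> (positional_min \<tau>) j" and ?r = "max_node_at \<phi> (positional_min \<tau>) j"
  let ?S = "\<lambda>N. \<Sum>t<N. - (A $ ?r t $ ?c t) + B $ ?r t $ ?c (Suc t)"
  obtain K where K: "\<And>i. \<bar>u $ i + T * \<eta> $ i\<bar> \<le> K"
    using bounded_fun_finite[of "\<lambda>i. u $ i + T * \<eta> $ i"] by metis
  have "?S N + ray u \<eta> s $ ?c N \<le> ray u \<eta> (s + real N) $ j" if "T \<le> s" for s N
    using that
  proof (induction N arbitrary: s)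
    case (Suc N)
    have "?S (Suc N) + ray u \<eta> s $ ?c (Suc N)
        = ?S N + (- (A $ ?r N $ ?c N) + (B $ ?r N $ ?c (Suc N) + ray u \<eta> s $ ?c (Suc N)))"
      by (simp add: add.assoc del: ray_nth)
    also have "- (A $ ?r N $ ?c N) + (B $ ?r N $ ?c (Suc N) + ray u \<eta> s $ ?c (Suc N)) \<le> ray u \<eta> (s + 1) $ ?c N"
      using assms Suc.prems unfolding min_ray_def max_node_at_positional_min by blast
    then have "?S N + (- (A $ ?r N $ ?c N) + (B $ ?r N $ ?c (Suc N) + ray u \<eta> s $ ?c (Suc N)))
        \<le> ?S N + ray u \<eta> (s + 1) $ ?c N"
      by (rule add_left_mono)
    also have "\<dots> \<le> ray u \<eta> ((s + 1) + real N) $ j"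
      using Suc.prems by (intro Suc.IH) simp
    also have "\<dots> = ray u \<eta> (s + real (Suc N)) $ j"
      by (simp add: add.assoc)
    finally show ?case .
  qed simp
  then have bound: "?S N + ray u \<eta> T $ ?c N \<le> ray u \<eta> (T + real N) $ j" for N by simp
  have "?S N \<le> ereal (u $ j + T * \<eta> $ j + K + real N * \<eta> $ j)" for N
    using bound[of N] K[of "?c N"] by (cases "?S N") (auto simp: algebra_simps)
  then have le: "\<forall>\<^sub>F N in sequentially. mean_payoff A B \<phi> (positional_min \<tau>) j N
      \<le> ereal ((u $ j + T * \<eta> $ j + K + real N * \<eta> $ j) / real N)"
    unfolding mean_payoff_def
    by (intro eventually_mono[OF eventually_gt_at_top[of 0]] ereal_divide_nat_mono(2))
  have "(\<lambda>N. ereal ((u $ j + T * \<eta> $ j + K + real N * \<eta> $ j) / real N)) \<longlonglongrightarrow> ereal (\<eta> $ j)"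
    using tendsto_affine_over_n by simp
  from lim_imp_Limsup[OF sequentially_bot this] Limsup_mono[OF le]
  show "limsup (mean_payoff A B \<phi> (positional_min \<tau>) j) \<le> ereal (\<eta> $ j)" by simp
qed

text \<open>The guarantees place \<open>v\<close> below the lower value and above the upper value,
  while the exchange of SUP and INF together with liminf \<le> limsup orders the two values the
  other way.\<close>

lemma is_game_value_if_secured:
  assumes \<phi>: "\<phi> \<in> max_policies B" "\<And>j. max_secures A B \<phi> j (v $ j)"
    and \<psi>: "\<psi> \<in> min_policies A" "\<And>j. min_secures A B \<psi> j (v $ j)"
  shows "is_game_value A B v"
proof -
  have "ereal (v $ j) \<le> lower_value A B j" for j
    unfolding lower_value_def using \<phi>
    by (intro SUP_upper2[of \<phi>] INF_greatest) (auto simp: max_secures_def)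
  moreover have "upper_value A B j \<le> ereal (v $ j)" for j
    unfolding upper_value_def using \<psi>
    by (intro INF_lower2[of \<psi>] SUP_least) (auto simp: min_secures_def)
  moreover have "lower_value A B j \<le> upper_value A B j" for j
    unfolding lower_value_def upper_value_def
    by (intro SUP_least INF_greatest)
      (blast intro: INF_lower2 SUP_upper2 Liminf_le_Limsup[OF sequentially_bot])
  ultimately show ?thesis
    unfolding is_game_value_def by (metis antisym order_trans)
qed

lemma (in mp_game) game_value:
  shows "has_cycle_time (minmax_fun A B) (cycle_time (minmax_fun A B))"
    and "is_game_value A B v \<longleftrightarrow> v = cycle_time (minmax_fun A B)"
    and "\<exists>\<sigma>\<in>max_strategies B. \<exists>\<tau>\<in>min_strategies A. \<forall>j.
      max_secures A B (positional_max \<sigma>) j (cycle_time (minmax_fun A B) $ j) \<and>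
      min_secures A B (positional_min \<tau>) j (cycle_time (minmax_fun A B) $ j)"
proof -
  obtain \<sigma> \<tau> u \<eta> T where \<sigma>\<tau>: "\<sigma> \<in> max_strategies B" "\<tau> \<in> min_strategies A"
    and rays: "max_ray A B \<sigma> u \<eta> T" "min_ray A B \<tau> u \<eta> T"
    by (rule saddle_ray)
  note \<eta> = saddle_ray_cycle_times(1)[OF rays]
  note secures = max_secures_if_max_ray[OF rays(1)] min_secures_if_min_ray[OF rays(2)]
  have "is_game_value A B \<eta>"
    using is_game_value_if_secured[OF positional_max_policy[OF \<sigma>\<tau>(1)] secures(1)
      positional_min_policy[OF \<sigma>\<tau>(2)] secures(2)] .
  moreover have "v = w" if "is_game_value A B v" "is_game_value A B w" for v w
    using that by (simp add: is_game_value_def vec_eq_iff)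
  ultimately show "is_game_value A B v \<longleftrightarrow> v = cycle_time (minmax_fun A B)"
    unfolding cycle_time_eq[OF \<eta>] by blast
  show "has_cycle_time (minmax_fun A B) (cycle_time (minmax_fun A B))"
    using \<eta> unfolding cycle_time_eq[OF \<eta>] .
  show "\<exists>\<sigma>\<in>max_strategies B. \<exists>\<tau>\<in>min_strategies A. \<forall>j.
      max_secures A B (positional_max \<sigma>) j (cycle_time (minmax_fun A B) $ j) \<and>
      min_secures A B (positional_min \<tau>) j (cycle_time (minmax_fun A B) $ j)"
    using \<sigma>\<tau> secures unfolding cycle_time_eq[OF \<eta>] by blast
qed

text \<open>By residuation, A \<otimes> x \<le> B \<otimes> x says that the min-max function does
  not decrease \<open>x\<close>. Such a point forces nonnegative growth; conversely, nonnegative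
  slopes make the point of the ray at \<open>T\<close> such a point.\<close>

lemma (in mp_game) cycle_time_nonneg_iff:
  "(\<forall>j. cycle_time (minmax_fun A B) $ j \<ge> 0) \<longleftrightarrow>
    (\<exists>x. \<forall>i j. A $ i $ j + ereal (x $ j) \<le> mp_mult B (ereal_vec x) $ i)" (is "?L \<longleftrightarrow> ?R")
proof -
  obtain \<sigma> \<tau> u \<eta> T where "max_ray A B \<sigma> u \<eta> T" "min_ray A B \<tau> u \<eta> T"
    by (rule saddle_ray)
  note \<eta> = saddle_ray_cycle_times(1)[OF this] and ray = minmax_fun_ray[OF this order_refl]
  have move: "- a + y \<ge> ereal x \<longleftrightarrow> a + ereal x \<le> y" if "a \<noteq> \<infinity>" "y \<noteq> \<infinity>" for a y x
    using that by (cases a; cases y) auto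
  have finite: "mp_mult B (ereal_vec x) $ i \<noteq> \<infinity>" for x i
  proof -
    have "mp_mult B (ereal_vec x) $ i \<in> range (\<lambda>l. B $ i $ l + ereal_vec x $ l)"
      unfolding mp_mult_def vec_lambda_beta by (intro Max_in) auto
    then obtain l where "mp_mult B (ereal_vec x) $ i = B $ i $ l + ereal_vec x $ l" by blast
    then show ?thesis
      using B_not_PInf[of i l] by (simp add: ereal_vec_def)
  qed
  have super: "ereal_vec x \<le> minmax_fun A B (ereal_vec x) \<longleftrightarrow>
      (\<forall>i j. A $ i $ j + ereal (x $ j) \<le> mp_mult B (ereal_vec x) $ i)" for x
  proof -
    have "ereal_vec x \<le> minmax_fun A B (ereal_vec x) \<longleftrightarrow>
        (\<forall>j i. ereal (x $ j) \<le> - (A $ i $ j) + mp_mult B (ereal_vec x) $ i)"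
      by (simp add: less_eq_vec_def minmax_fun_def) (simp add: ereal_vec_def)
    then show ?thesis
      using move[OF A_not_PInf finite] by blast
  qed
  show ?thesis
  proof
    assume ?L
    then have "\<And>j. \<eta> $ j \<ge> 0" unfolding cycle_time_eq[OF \<eta>] by blast
    then have "ray u \<eta> T \<le> minmax_fun A B (ray u \<eta> T)"
      unfolding ray less_eq_vec_def by (simp add: distrib_right)
    then show ?R unfolding ray_def super by blast
  next
    assume ?R
    then obtain x where "ereal_vec x \<le> minmax_fun A B (ereal_vec x)"
      unfolding super by blast
    then show ?L
      using topical_minmax_fun[of A B] cycle_time_nonneg[OF \<eta>]
      unfolding cycle_time_eq[OF \<eta>] topical_def by blast
  qed
qed

section \<open>Cycles of the one-player game\<close>

text \<open>A potential \<open>\<nu> + t * h\<close> that also depends on a clock \<open>t\<close>,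
  of which each arc uses up one unit. For constant \<open>h\<close> it is the usual certificate of a
  lower bound on cycle means; varying \<open>h\<close> lets the bound depend on the node.\<close>

locale potential_digraph = wf_digraph G for G :: "('v, 'e) pre_digraph" (structure) +
  fixes wt :: "'e \<Rightarrow> real" and \<nu> h :: "'v \<Rightarrow> real" and T :: real
  assumes potential: "e \<in> arcs G \<Longrightarrow> T \<le> t \<Longrightarrow>
    \<nu> (tail G e) + (t + 1) * h (tail G e) \<le> wt e + (\<nu> (head G e) + t * h (head G e))"
begin

lemma walk_potential:
  assumes "cas u p v" "set p \<subseteq> arcs G" "T \<le> t"
  shows "\<nu> u + (t + real (length p)) * h u \<le> (\<Sum>e\<leftarrow>p. wt e) + (\<nu> v + t * h v)"
  using assms
proof (induction p arbitrary: u)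
  case (Cons e p)
  then have e: "tail G e = u" "e \<in> arcs G" "T \<le> t + real (length p)" by auto
  have "\<nu> (head G e) + (t + real (length p)) * h (head G e) \<le> (\<Sum>e\<leftarrow>p. wt e) + (\<nu> v + t * h v)"
    using Cons by auto
  with potential[OF e(2,3)] e(1) show ?case by (simp add: algebra_simps)
qed simp

text \<open>The potential inequality holds for arbitrarily large \<open>t\<close>, where the slopes
  decide.\<close>

lemma mono_arc:
  assumes "e \<in> arcs G"
  shows "h (tail G e) \<le> h (head G e)"
proof (rule ccontr)
  assume *: "\<not> h (tail G e) \<le> h (head G e)"
  define D where "D = h (tail G e) - h (head G e)"
  define K where "K = wt e + \<nu> (head G e) - \<nu> (tail G e) - h (tail G e)"
  \<comment> \<open>The inequality amounts to t D \<le> K, and this \<open>t\<close> lies past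
    \<open>K / D\<close>.\<close>
  define t where "t = max T (K / D + 1)"
  have "D > 0" using * by (simp add: D_def)
  have "K < (K / D + 1) * D" using \<open>D > 0\<close> by (simp add: field_simps)
  also have "\<dots> \<le> t * D" using \<open>D > 0\<close> by (intro mult_right_mono) (auto simp: t_def)
  finally have "K < t * D" .
  moreover have "T \<le> t" by (simp add: t_def)
  ultimately show False
    using potential[OF assms, of t] by (simp add: D_def K_def algebra_simps)
qed

lemma mono_reachable: "u \<rightarrow>\<^sup>* v \<Longrightarrow> h u \<le> h v"
proof (induction rule: reachable_induct)
  case (step x y)
  then obtain e where "e \<in> arcs G" "tail G e = x" "head G e = y"
    by (auto simp: arcs_ends_def arc_to_ends_def)
  with mono_arc[of e] step show ?case by simp
qed simp

lemma mono_walk: "cas u p v \<Longrightarrow> set p \<subseteq> arcs G \<Longrightarrow> h u \<le> h v"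
proof (induction p arbitrary: u)
  case (Cons e p)
  then have "h (head G e) \<le> h v" by auto
  with mono_arc[of e] Cons.prems show ?case by auto
qed simp

lemma mono_walk_tail: "cas u p v \<Longrightarrow> set p \<subseteq> arcs G \<Longrightarrow> e \<in> set p \<Longrightarrow> h (tail G e) \<le> h v"
proof (induction p arbitrary: u)
  case (Cons e' p)
  show ?case
  proof (cases "e = e'")
    case True
    then show ?thesis using mono_walk[of u "e' # p" v] Cons.prems by auto
  next
    case False
    then show ?thesis using Cons by auto
  qed
qed simp

text \<open>Around a closed walk based at u the values of \<open>\<nu>\<close> cancel, which leaves
  \<open>length p\<close> times \<open>h\<close> at u as a lower bound. The slope can only grow on
  the way from \<open>v\<close> to the walk and then along it to u.\<close>

lemma closed_walk_mean_ge:
  assumes "closed_w p" "accessible G v p"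
  shows "real (length p) * h v \<le> (\<Sum>e\<leftarrow>p. wt e)"
proof -
  obtain u where u: "cas u p u" "set p \<subseteq> arcs G"
    using assms(1) by (auto simp: closed_w_def awalk_def)
  obtain e where e: "e \<in> set p" "v \<rightarrow>\<^sup>* tail G e"
    using assms(2) by (auto simp: accessible_def)
  have "h v \<le> h u"
    using mono_reachable[OF e(2)] mono_walk_tail[OF u e(1)] by simp
  then have "real (length p) * h v \<le> real (length p) * h u"
    by (rule mult_left_mono) simp
  also have "\<dots> \<le> (\<Sum>e\<leftarrow>p. wt e)"
    using walk_potential[OF u order_refl] by (simp add: algebra_simps)
  finally show ?thesis .
qed

end

section \<open>Orbits of a successor map and the cycles they enter\<close>

primrec orbit_walk :: "('v \<Rightarrow> 'v) \<Rightarrow> nat \<Rightarrow> 'v \<Rightarrow> ('v \<times> 'v) list" where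
  "orbit_walk s 0 x = []"
| "orbit_walk s (Suc n) x = (x, s x) # orbit_walk s n (s x)"

lemma length_orbit_walk [simp]: "length (orbit_walk s n x) = n"
  by (induction n arbitrary: x) auto

text \<open>Idempotence makes \<open>(s ^^ N) x\<close> periodic, and within its least period
  nothing repeats. The index range starts at 1 because a cycle must have distinct vertices after its
  first one, which recurs at the end.\<close>

lemma funpow_first_return:
  fixes s :: "'a::finite \<Rightarrow> 'a"
  obtains N n where "n > 0" "(s ^^ n) ((s ^^ N) x) = (s ^^ N) x"
    "inj_on (\<lambda>k. (s ^^ k) ((s ^^ N) x)) {1..n}"
proof -
  obtain N where N: "N > 0" "s ^^ (N + N) = s ^^ N"
    by (rule funpow_eventually_idempotent)
  define y where "y = (s ^^ N) x"
  have "(s ^^ N) y = (s ^^ (N + N)) x"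
    by (simp add: y_def funpow_add)
  then have "(s ^^ N) y = y"
    unfolding N(2) y_def .
  then have ex: "\<exists>n. n > 0 \<and> (s ^^ n) y = y" using N(1) by blast
  define n where "n = (LEAST n. n > 0 \<and> (s ^^ n) y = y)"
  have n: "n > 0" "(s ^^ n) y = y"
    using LeastI_ex[OF ex] by (auto simp: n_def)
  have least: "m \<ge> n" if "m > 0" "(s ^^ m) y = y" for m
    using that by (auto simp: n_def intro: Least_le)
  have "inj_on (\<lambda>k. (s ^^ k) y) {1..n}"
  proof (rule linorder_inj_onI)
    fix a b assume ab: "a < b" "a \<in> {1..n}" "b \<in> {1..n}"
    show "(s ^^ a) y \<noteq> (s ^^ b) y"
    proof
      assume "(s ^^ a) y = (s ^^ b) y"
      \<comment> \<open>Applying \<open>s ^^ (n - b)\<close> carries the later point on to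
        \<open>y\<close>, so the earlier one would yield a return before \<open>n\<close>.\<close>
      then have "(s ^^ (n - b + a)) y = (s ^^ (n - b + b)) y"
        by (simp add: funpow_add)
      then have "(s ^^ (n - b + a)) y = y" using ab n by simp
      moreover have "0 < n - b + a" "n - b + a < n" using ab by auto
      ultimately show False using least[of "n - b + a"] by simp
    qed
  qed auto
  with n show thesis by (intro that[of n N]) (simp_all add: y_def)
qed

text \<open>\<open>s\<close> selects one outgoing arc at every vertex, as a pair of positional
  strategies does.\<close>

locale functional_subgraph = wf_digraph G for G :: "('v::finite, 'v \<times> 'v) pre_digraph" (structure) +
  fixes s :: "'v \<Rightarrow> 'v"
  assumes verts [simp]: "verts G = UNIV" and tail [simp]: "tail G = fst" and head [simp]: "head G = snd"
    and orbit_arc: "(x, s x) \<in> arcs G"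
begin

lemma cas_orbit_walk: "cas x (orbit_walk s n x) ((s ^^ n) x)"
  by (induction n arbitrary: x) (auto simp: funpow_swap1)

lemma set_orbit_walk: "set (orbit_walk s n x) \<subseteq> arcs G"
  by (induction n arbitrary: x) (auto simp: orbit_arc)

lemma awalk_verts_orbit_walk: "awalk_verts x (orbit_walk s n x) = map (\<lambda>k. (s ^^ k) x) [0..<Suc n]"
proof (induction n arbitrary: x)
  case (Suc n)
  have "map (\<lambda>k. (s ^^ k) x) [0..<Suc (Suc n)] = x # map (\<lambda>k. (s ^^ Suc k) x) [0..<Suc n]"
    by (subst upt_conv_Cons) (simp_all add: map_Suc_upt[symmetric] del: upt_Suc)
  then show ?case by (simp add: Suc funpow_swap1 del: upt_Suc)
qed simp

lemma reachable_orbit: "x \<rightarrow>\<^sup>* (s ^^ n) x"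
proof (induction n)
  case (Suc n)
  have "(s ^^ n) x \<rightarrow>\<^bsub>G\<^esub> (s ^^ Suc n) x"
    using orbit_arc[of "(s ^^ n) x"] by (auto simp: arcs_ends_def arc_to_ends_def image_iff)
  with Suc show ?case by (rule reachable_adj_trans)
qed simp

lemma elementary_cycle_in_orbit:
  obtains n N where "n > 0" "(s ^^ n) ((s ^^ N) x) = (s ^^ N) x"
    "orbit_walk s n ((s ^^ N) x) \<in> elementary_cycles G x"
proof -
  obtain N n where n: "n > 0" "(s ^^ n) ((s ^^ N) x) = (s ^^ N) x"
    "inj_on (\<lambda>k. (s ^^ k) ((s ^^ N) x)) {1..n}"
    by (rule funpow_first_return)
  define y where "y = (s ^^ N) x"
  have "cycle (orbit_walk s n y)"
    unfolding cycle_def awalk_def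
  proof (intro exI conjI)
    show "cas y (orbit_walk s n y) y"
      using cas_orbit_walk[of y n] n(2) by (simp add: y_def)
    have "tl (awalk_verts y (orbit_walk s n y)) = map (\<lambda>k. (s ^^ k) y) [1..<Suc n]"
      by (simp add: awalk_verts_orbit_walk upt_conv_Cons del: upt_Suc)
    also have "distinct \<dots>"
      using n(3) by (simp add: distinct_map y_def atLeastLessThanSuc_atLeastAtMost del: upt_Suc)
    finally show "distinct (tl (awalk_verts y (orbit_walk s n y)))" .
    show "orbit_walk s n y \<noteq> []"
      using n(1) by (metis length_orbit_walk length_0_conv less_not_refl)
  qed (simp_all add: set_orbit_walk)
  moreover have "accessible G x (orbit_walk s n y)"
  proof -
    have "(y, s y) \<in> set (orbit_walk s n y)"
      using n(1) by (cases n) auto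
    then show ?thesis
      unfolding accessible_def using reachable_orbit[of x N] by (intro bexI[of _ "(y, s y)"]) (auto simp: y_def)
  qed
  ultimately show thesis
    using n by (intro that[of n N]) (auto simp: elementary_cycles_def y_def)
qed

end

section \<open>The digraph of the one-player game\<close>

instance node :: (finite, finite) finite
proof
  have "(UNIV :: ('a, 'b) node set) = range Max_node \<union> range Min_node"
  proof (intro set_eqI iffI UNIV_I)
    fix x :: "('a, 'b) node"
    show "x \<in> range Max_node \<union> range Min_node" by (cases x) simp_all
  qed
  then show "finite (UNIV :: ('a, 'b) node set)"
    by (metis finite_UnI finite_imageI finite)
qed

lemma one_player_game_simps [simp]:
  "verts (one_player_game A \<sigma>) = UNIV"
  "tail (one_player_game A \<sigma>) = fst" "head (one_player_game A \<sigma>) = snd"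
  by (simp_all add: one_player_game_def)

lemma arcs_one_player_game:
  "(Min_node j, Max_node i) \<in> arcs (one_player_game A \<sigma>) \<longleftrightarrow> A $ i $ j \<noteq> -\<infinity>"
  "(Max_node i, Min_node j) \<in> arcs (one_player_game A \<sigma>) \<longleftrightarrow> j = \<sigma> i"
  "(Max_node i, Max_node i') \<notin> arcs (one_player_game A \<sigma>)"
  "(Min_node j, Min_node j') \<notin> arcs (one_player_game A \<sigma>)"
  by (auto simp: one_player_game_def)

lemma one_player_game_arc_cases:
  assumes "e \<in> arcs (one_player_game A \<sigma>)"
  obtains (Min) j i where "e = (Min_node j, Max_node i)" "A $ i $ j \<noteq> -\<infinity>"
  | (Max) i where "e = (Max_node i, Min_node (\<sigma> i))"
  using assms by (auto simp: one_player_game_def)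

lemma wf_one_player_game: "wf_digraph (one_player_game A \<sigma>)"
  by unfold_locales auto

lemma out_degree_Max_node: "out_degree (one_player_game A \<sigma>) (Max_node i) = 1"
proof -
  have "out_arcs (one_player_game A \<sigma>) (Max_node i) = {(Max_node i, Min_node (\<sigma> i))}"
    by (auto simp: one_player_game_def)
  then show ?thesis by (simp add: out_degree_def)
qed

lemma finite_elementary_cycles:
  fixes A :: "ereal ^ 'c::finite ^ 'r::finite"
  shows "finite (elementary_cycles (one_player_game A \<sigma>) v)"
proof -
  interpret wf_digraph "one_player_game A \<sigma>" by (rule wf_one_player_game)
  have "elementary_cycles (one_player_game A \<sigma>) v
      \<subseteq> {p. set p \<subseteq> arcs (one_player_game A \<sigma>) \<and> distinct p}"
    by (auto simp: elementary_cycles_def cycle_conv awalk_def)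
  then show ?thesis
    by (rule finite_subset) (intro finite_subset_distinct finite)
qed

lemma elementary_cycles_subset_closed_walks:
  "elementary_cycles (one_player_game A \<sigma>) v \<subseteq> closed_walks (one_player_game A \<sigma>) v"
proof -
  interpret wf_digraph "one_player_game A \<sigma>" by (rule wf_one_player_game)
  show ?thesis
    by (auto simp: elementary_cycles_def closed_walks_def cycle_altdef)
qed

fun positional_successor :: "('r \<Rightarrow> 'c) \<Rightarrow> ('c \<Rightarrow> 'r) \<Rightarrow> ('r, 'c) node \<Rightarrow> ('r, 'c) node" where
  "positional_successor \<sigma> \<tau> (Max_node i) = Min_node (\<sigma> i)"
| "positional_successor \<sigma> \<tau> (Min_node j) = Max_node (\<tau> j)"

lemma functional_subgraph_one_player_game:
  fixes A :: "ereal ^ 'c::finite ^ 'r::finite"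
  assumes "\<tau> \<in> min_strategies A"
  shows "functional_subgraph (one_player_game A \<sigma>) (positional_successor \<sigma> \<tau>)"
proof -
  interpret wf_digraph "one_player_game A \<sigma>" by (rule wf_one_player_game)
  show ?thesis
  proof
    show "(x, positional_successor \<sigma> \<tau> x) \<in> arcs (one_player_game A \<sigma>)" for x
      using assms by (cases x) (simp_all add: arcs_one_player_game min_strategies_def)
  qed simp_all
qed

text \<open>On the arcs of the game of a strategy of Max the entries are finite, so
  \<open>real_of_ereal\<close> loses nothing there.\<close>

fun arc_weight :: "ereal ^ 'c ^ 'r \<Rightarrow> ereal ^ 'c ^ 'r \<Rightarrow> ('r, 'c) arc \<Rightarrow> real" where
  "arc_weight A B (Min_node j, Max_node i) = - real_of_ereal (A $ i $ j)"
| "arc_weight A B (Max_node i, Min_node j) = real_of_ereal (B $ i $ j)"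
| "arc_weight A B _ = 0"

context mp_game
begin

text \<open>Any positional answer of Min turns the game into a successor map, whose orbit from
  \<open>v\<close> runs into a cycle.\<close>

lemma elementary_cycles_nonempty: "elementary_cycles (one_player_game A \<sigma>) v \<noteq> {}"
proof -
  obtain \<tau> where "\<And>j. A $ \<tau> j $ j \<noteq> -\<infinity>"
    using choice[of "\<lambda>j i. A $ i $ j \<noteq> -\<infinity>"] A_column by blast
  then have \<tau>: "\<tau> \<in> min_strategies A"
    by (simp add: min_strategies_def)
  interpret functional_subgraph "one_player_game A \<sigma>" "positional_successor \<sigma> \<tau>"
    by (rule functional_subgraph_one_player_game[OF \<tau>])
  obtain n N where "orbit_walk (positional_successor \<sigma> \<tau>) n ((positional_successor \<sigma> \<tau> ^^ N) v)
      \<in> elementary_cycles (one_player_game A \<sigma>) v"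
    by (rule elementary_cycle_in_orbit[of v]) (rule that)
  then show ?thesis by (rule ex_in_conv[THEN iffD1, OF exI])
qed

text \<open>
  Each move counts as half a turn, so that a Min node and a Max node of the same play lie on one
  half-line of slope \<open>\<eta> / 2\<close>.
\<close>

lemma cycle_time_closed_walk_and_cycle:
  assumes \<sigma>: "\<sigma> \<in> max_strategies B"
  shows "\<gamma> \<in> closed_walks (one_player_game A \<sigma>) (Min_node j) \<Longrightarrow>
      cycle_time (fun_max_strat A B \<sigma>) $ j \<le> (\<Sum>e\<leftarrow>\<gamma>. arc_weight A B e) / (real (length \<gamma>) / 2)"
    and "\<exists>\<gamma>\<in>elementary_cycles (one_player_game A \<sigma>) (Min_node j).
      cycle_time (fun_max_strat A B \<sigma>) $ j = (\<Sum>e\<leftarrow>\<gamma>. arc_weight A B e) / (real (length \<gamma>) / 2)"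
proof -
  let ?G = "one_player_game A \<sigma>" and ?wt = "arc_weight A B"
  obtain \<tau> u \<eta> T where \<tau>: "\<tau> \<in> min_strategies A" and max_ray: "max_ray A B \<sigma> u \<eta> T"
    and opt: "\<And>t j. T \<le> t \<Longrightarrow>
      - (A $ \<tau> j $ j) + (B $ \<tau> j $ \<sigma> (\<tau> j) + ray u \<eta> t $ \<sigma> (\<tau> j)) \<le> ray u \<eta> (t + 1) $ j"
    by (rule one_player_max_ray[OF \<sigma>]) (rule that)
  have "has_cycle_time (fun_max_strat A B \<sigma>) \<eta>"
    using max_ray opt by (intro has_cycle_time_if_ray topical_fun_max_strat fun_max_strat_ray)
  then have \<eta>: "cycle_time (fun_max_strat A B \<sigma>) = \<eta>" by (rule cycle_time_eq)
  \<comment> \<open>The value at a Max node makes the potential inequality an equality on its single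
    arc; subtracting half of \<eta> accounts for the half turn that this arc lasts.\<close>
  define \<nu> where "\<nu> v = (case v of Min_node j \<Rightarrow> u $ j
    | Max_node i \<Rightarrow> real_of_ereal (B $ i $ \<sigma> i) + u $ \<sigma> i - \<eta> $ \<sigma> i / 2)" for v
  define h where "h v = (case v of Min_node j \<Rightarrow> \<eta> $ j / 2 | Max_node i \<Rightarrow> \<eta> $ \<sigma> i / 2)" for v
  have A_real: "A $ i $ j = ereal (real_of_ereal (A $ i $ j))" if "A $ i $ j \<noteq> -\<infinity>" for i j
    using that A_not_PInf[of i j] by (cases "A $ i $ j") auto
  have B_real: "B $ i $ \<sigma> i = ereal (real_of_ereal (B $ i $ \<sigma> i))" for i
    using \<sigma> B_not_PInf[of i "\<sigma> i"] by (cases "B $ i $ \<sigma> i") (auto simp: max_strategies_def)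
  have Max_arc: "\<nu> (Max_node i) + (t + 1) * h (Max_node i) =
      ?wt (Max_node i, Min_node (\<sigma> i)) + (\<nu> (Min_node (\<sigma> i)) + t * h (Min_node (\<sigma> i)))" for i t
    by (simp add: \<nu>_def h_def field_simps)
  have le: "u $ j + (t + 1) * \<eta> $ j
      \<le> - real_of_ereal (A $ i $ j) + (real_of_ereal (B $ i $ \<sigma> i) + (u $ \<sigma> i + t * \<eta> $ \<sigma> i))"
    if "A $ i $ j \<noteq> -\<infinity>" "T \<le> t" for i j t
  proof -
    have "ray u \<eta> (t + 1) $ j \<le> - (A $ i $ j) + (B $ i $ \<sigma> i + ray u \<eta> t $ \<sigma> i)"
      using max_ray that(2) unfolding max_ray_def by blast
    then show ?thesis
      by (subst (asm) A_real[OF that(1)], subst (asm) B_real) simp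
  qed
  have ge: "- real_of_ereal (A $ \<tau> j $ j) + (real_of_ereal (B $ \<tau> j $ \<sigma> (\<tau> j)) + (u $ \<sigma> (\<tau> j) + t * \<eta> $ \<sigma> (\<tau> j)))
      \<le> u $ j + (t + 1) * \<eta> $ j" if "T \<le> t" for j t
  proof -
    have finite: "A $ \<tau> j $ j \<noteq> -\<infinity>" using \<tau> by (simp add: min_strategies_def)
    from opt[OF that, of j] show ?thesis
      by (subst (asm) A_real[OF finite], subst (asm) B_real) simp
  qed
  interpret wf_digraph ?G by (rule wf_one_player_game)
  \<comment> \<open>At a Min arc the clock value \<open>t\<close> corresponds to the ray parameter
    \<open>(t - 1) / 2\<close>, which is at least \<open>T\<close> from \<open>2 * T + 1\<close>
    on.\<close>
  interpret potential_digraph ?G ?wt \<nu> h "2 * T + 1"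
  proof
    fix e t assume e: "e \<in> arcs ?G" and t: "2 * T + 1 \<le> t"
    from e show "\<nu> (tail ?G e) + (t + 1) * h (tail ?G e) \<le> ?wt e + (\<nu> (head ?G e) + t * h (head ?G e))"
    proof (cases rule: one_player_game_arc_cases)
      case (Min j i)
      with le[of i j "(t - 1) / 2"] t show ?thesis by (simp add: \<nu>_def h_def field_simps)
    next
      case (Max i)
      then show ?thesis using Max_arc[of i t] by simp
    qed
  qed
  show lower: "cycle_time (fun_max_strat A B \<sigma>) $ j \<le> (\<Sum>e\<leftarrow>\<gamma>. ?wt e) / (real (length \<gamma>) / 2)"
    if "\<gamma> \<in> closed_walks ?G (Min_node j)" for \<gamma>
  proof -
    have "length \<gamma> > 0"
      using that by (auto simp: closed_walks_def closed_w_def)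
    moreover have "real (length \<gamma>) * h (Min_node j) \<le> (\<Sum>e\<leftarrow>\<gamma>. ?wt e)"
      using that by (intro closed_walk_mean_ge) (auto simp: closed_walks_def)
    ultimately show ?thesis by (simp add: \<eta> h_def field_simps)
  qed
  define s where "s = positional_successor \<sigma> \<tau>"
  interpret functional_subgraph ?G s
    unfolding s_def by (rule functional_subgraph_one_player_game[OF \<tau>])
  \<comment> \<open>Along the arcs chosen by \<open>\<sigma>\<close> and \<open>\<tau>\<close> the
    potential inequality is tight, \<open>\<tau>\<close> being an optimal answer to
    \<open>\<sigma>\<close>.\<close>
  have orbit_eq: "\<nu> v + (t + 1) * h v = ?wt (v, s v) + (\<nu> (s v) + t * h (s v))" if "2 * T + 1 \<le> t" for v t
  proof (cases v)
    case (Max_node i)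
    then show ?thesis using Max_arc[of i t] by (simp add: s_def)
  next
    case (Min_node j)
    have "\<nu> v + (t + 1) * h v \<ge> ?wt (v, s v) + (\<nu> (s v) + t * h (s v))"
      using ge[of "(t - 1) / 2" j] that unfolding Min_node
      by (simp add: s_def \<nu>_def h_def field_simps)
    then show ?thesis
      using potential[OF orbit_arc that, of v] by simp
  qed
  \<comment> \<open>An identity between affine functions of \<open>t\<close>, compared at two times
    one unit apart, forces equal slopes.\<close>
  have h_s: "h (s v) = h v" for v
    using orbit_eq[of "2 * T + 1" v] orbit_eq[of "2 * T + 2" v] by (simp add: algebra_simps)
  have h_orbit: "h ((s ^^ n) v) = h v" for n v
    by (induction n) (simp_all add: h_s)
  have orbit_sum: "\<nu> v + real n * h v = (\<Sum>e\<leftarrow>orbit_walk s n v. ?wt e) + \<nu> ((s ^^ n) v)" for n v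
  proof (induction n arbitrary: v)
    case (Suc n)
    have "\<nu> v + h v = ?wt (v, s v) + \<nu> (s v)"
      using orbit_eq[of "2 * T + 1" v] by (simp add: h_s algebra_simps)
    with Suc[of "s v"] show ?case by (simp add: h_s funpow_swap1 algebra_simps)
  qed simp
  obtain n N where n: "n > 0" "(s ^^ n) ((s ^^ N) (Min_node j)) = (s ^^ N) (Min_node j)"
    and cycle: "orbit_walk s n ((s ^^ N) (Min_node j)) \<in> elementary_cycles ?G (Min_node j)"
    by (rule elementary_cycle_in_orbit)
  \<comment> \<open>\<open>\<nu>\<close> cancels over one period, and the slope on the cycle is
    still that of the starting node.\<close>
  have "real n * h (Min_node j) = (\<Sum>e\<leftarrow>orbit_walk s n ((s ^^ N) (Min_node j)). ?wt e)"
    using orbit_sum[of "(s ^^ N) (Min_node j)" n] n(2) by (simp add: h_orbit)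
  then have "\<eta> $ j = (\<Sum>e\<leftarrow>orbit_walk s n ((s ^^ N) (Min_node j)). ?wt e) / (real n / 2)"
    using n(1) by (simp add: h_def field_simps)
  with cycle show "\<exists>\<gamma>\<in>elementary_cycles ?G (Min_node j).
      cycle_time (fun_max_strat A B \<sigma>) $ j = (\<Sum>e\<leftarrow>\<gamma>. ?wt e) / (real (length \<gamma>) / 2)"
    by (intro bexI[of _ "orbit_walk s n ((s ^^ N) (Min_node j))"]) (simp_all add: \<eta>)
qed

end

section \<open>The block matrices\<close>

lemma continuous_on_Min_image:
  fixes f :: "'i \<Rightarrow> 'a::topological_space \<Rightarrow> 'b::linorder_topology"
  assumes "finite I" "I \<noteq> {}" "\<And>i. i \<in> I \<Longrightarrow> continuous_on S (f i)"
  shows "continuous_on S (\<lambda>x. MIN i\<in>I. f i x)"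
  using assms
proof (induction I rule: finite_ne_induct)
  case (insert i I)
  then show ?case by (simp add: continuous_on_min)
qed simp

text \<open>On \<open>P i\<close> the function with index \<open>i\<close> is the smallest, and each
  \<open>P i\<close> is a finite intersection of half-spaces.\<close>

lemma piecewise_linear_Min_affine:
  fixes a :: "'i \<Rightarrow> 'a::euclidean_space"
  assumes "finite I" "I \<noteq> {}"
  shows "piecewise_linear (\<lambda>x. MIN i\<in>I. a i \<bullet> x + c i)"
proof -
  define P where "P i = (\<Inter>k\<in>I. {x. (a i - a k) \<bullet> x \<le> c k - c i})" for i
  have P: "x \<in> P i \<longleftrightarrow> (\<forall>k\<in>I. a i \<bullet> x + c i \<le> a k \<bullet> x + c k)" for x i
    by (auto simp: P_def inner_diff_left algebra_simps)
  have Min: "(MIN i\<in>I. a i \<bullet> x + c i) = a i \<bullet> x + c i" if "i \<in> I" "x \<in> P i" for i x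
    using that assms unfolding P by (intro Min_eqI) auto
  have "x \<in> \<Union> (P ` I)" for x
  proof -
    have "(MIN i\<in>I. a i \<bullet> x + c i) \<in> (\<lambda>i. a i \<bullet> x + c i) ` I"
      using assms by (intro Min_in) auto
    then obtain i where "i \<in> I" "(MIN i\<in>I. a i \<bullet> x + c i) = a i \<bullet> x + c i" by blast
    moreover have "(MIN i\<in>I. a i \<bullet> x + c i) \<le> a k \<bullet> x + c k" if "k \<in> I" for k
      using that assms(1) by (intro Min_le) auto
    ultimately show ?thesis by (auto simp: P)
  qed
  moreover have "polyhedron (P i)" for i
    unfolding P_def using assms(1) by (intro polyhedron_Inter) (auto simp: polyhedron_halfspace_le)
  moreover have "\<exists>a' c'. \<forall>x\<in>P i. (MIN i\<in>I. a i \<bullet> x + c i) = a' \<bullet> x + c'" if "i \<in> I" for i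
    using Min[OF that] by blast
  ultimately show ?thesis
    unfolding piecewise_linear_def using assms(1) by (intro exI[of _ "P ` I"]) auto
qed

section \<open>Feasibility as an inequality between max-plus products\<close>

lemma Max_col:
  fixes f :: "'n::finite col \<Rightarrow> 'a::linorder"
  shows "(MAX c. f c) = max (MAX j. f (Col j)) (f Last)"
proof -
  have UNIV_col: "(UNIV :: 'n col set) = insert Last (range Col)"
  proof (intro set_eqI iffI UNIV_I)
    fix c :: "'n col"
    show "c \<in> insert Last (range Col)" by (cases c) simp_all
  qed
  have "range f = insert (f Last) (range (\<lambda>j. f (Col j)))"
    by (simp only: UNIV_col image_insert image_image)
  then show ?thesis
    by (simp add: max.commute)
qed

lemma all_col: "(\<forall>c. P c) \<longleftrightarrow> (\<forall>j. P (Col j)) \<and> P Last"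
proof (intro iffI allI)
  fix c assume "(\<forall>j. P (Col j)) \<and> P Last"
  then show "P c" by (cases c) simp_all
qed simp

lemma all_row: "(\<forall>r. P r) \<longleftrightarrow> (\<forall>i. P (C1 i)) \<and> (\<forall>j. P (C2 j)) \<and> P C3 \<and> (\<forall>j. P (C4 j)) \<and> P C5"
proof (intro iffI allI)
  fix r assume "(\<forall>i. P (C1 i)) \<and> (\<forall>j. P (C2 j)) \<and> P C3 \<and> (\<forall>j. P (C4 j)) \<and> P C5"
  then show "P r" by (cases r) simp_all
qed simp

lemma mp_mult_B_mat:
  fixes V :: "ereal ^ 'n::finite ^ 'm::finite" and y :: "real ^ 'n col"
  shows "mp_mult (B_mat V d l1 l2) (ereal_vec y) $ C1 i =
      max (MAX j. V $ i $ j + ereal (y $ Col j)) (d $ i + ereal (y $ Last))"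
    and "mp_mult (B_mat V d l1 l2) (ereal_vec y) $ C2 j = ereal (l1 + y $ Col j)"
    and "mp_mult (B_mat V d l1 l2) (ereal_vec y) $ C3 = ereal (l1 + y $ Last)"
    and "mp_mult (B_mat V d l1 l2) (ereal_vec y) $ C4 j = ereal (l2 + y $ Col j)"
    and "mp_mult (B_mat V d l1 l2) (ereal_vec y) $ C5 = ereal (l2 + y $ Last)"
proof -
  have single: "(MAX c. (if c = k then ereal l else -\<infinity>) + ereal (y $ c)) = ereal (l + y $ k)" for k l
    by (rule Max_eqI) (auto intro!: image_eqI[of _ _ k])
  show "mp_mult (B_mat V d l1 l2) (ereal_vec y) $ C1 i =
      max (MAX j. V $ i $ j + ereal (y $ Col j)) (d $ i + ereal (y $ Last))"
    by (simp add: mp_mult_def B_mat_def ereal_vec_def Max_col)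
  show "mp_mult (B_mat V d l1 l2) (ereal_vec y) $ C2 j = ereal (l1 + y $ Col j)"
    "mp_mult (B_mat V d l1 l2) (ereal_vec y) $ C3 = ereal (l1 + y $ Last)"
    "mp_mult (B_mat V d l1 l2) (ereal_vec y) $ C4 j = ereal (l2 + y $ Col j)"
    "mp_mult (B_mat V d l1 l2) (ereal_vec y) $ C5 = ereal (l2 + y $ Last)"
    by (simp_all add: mp_mult_def B_mat_def ereal_vec_def single del: plus_ereal.simps)
qed

text \<open>The row groups separate the conditions: \<open>C1\<close> is the constraint system,
  \<open>C2\<close> and \<open>C3\<close> are the two halves of the bound on the first objective,
  \<open>C4\<close> and \<open>C5\<close> those of the second. With last coordinate 0, the last
  column enters unshifted.\<close>

lemma A_le_B_iff_feasible:
  fixes U V :: "ereal ^ 'n::finite ^ 'm::finite" and y :: "real ^ 'n col"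
  assumes "y $ Last = 0"
  shows "(\<forall>r c. A_mat U b p1 q1 p2 q2 $ r $ c + ereal (y $ c) \<le> mp_mult (B_mat V d l1 l2) (ereal_vec y) $ r)
    \<longleftrightarrow> feasible U b V d (\<chi> j. y $ Col j) \<and>
      objective p1 q1 (\<chi> j. y $ Col j) \<le> ereal l1 \<and> objective p2 q2 (\<chi> j. y $ Col j) \<le> ereal l2"
proof -
  have p: "p - ereal z \<le> ereal l \<longleftrightarrow> p \<le> ereal (l + z)" for p z l
    by (cases p) auto
  have q: "ereal z - q \<le> ereal l \<longleftrightarrow> - q + ereal z \<le> ereal l" for q z l
    by (simp add: minus_ereal_def add.commute)
  have y0: "a + ereal (y $ Last) = a" for a
    by (simp add: assms)
  have U: "(\<forall>j. U $ i $ j + ereal (y $ Col j) \<le> R) \<and> b $ i + ereal (y $ Last) \<le> R \<longleftrightarrow>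
      max (mp_mult U (ereal_vec (\<chi> j. y $ Col j)) $ i) (b $ i) \<le> R" for i R
    by (simp add: mp_mult_def ereal_vec_def y0)
  have V: "max (MAX j. V $ i $ j + ereal (y $ Col j)) (d $ i + ereal (y $ Last)) =
      max (mp_mult V (ereal_vec (\<chi> j. y $ Col j)) $ i) (d $ i)" for i
    by (simp add: mp_mult_def ereal_vec_def y0)
  have objective: "objective p q (\<chi> j. y $ Col j) \<le> ereal l \<longleftrightarrow>
      (\<forall>j. p $ j \<le> ereal (l + y $ Col j)) \<and> (\<forall>j. - (q $ j) + ereal (y $ Col j) \<le> ereal l)" for p q l
    unfolding objective_def by (simp only: max.bounded_iff Max.bounded_iff finite finite_imageI
      image_is_empty UNIV_not_empty ball_simps vec_lambda_beta p q ball_UNIV image_iff simp_thms)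
  show ?thesis
    unfolding all_row all_col mp_mult_B_mat objective feasible_def V U[symmetric]
    by (simp add: A_mat_def assms del: max.bounded_iff)
qed

text \<open>The inequality is unchanged when a constant is added to all coordinates of
  \<open>y\<close>, so the last one can be normalised to 0.\<close>

lemma feasibility_region_iff:
  fixes U V :: "ereal ^ 'n::finite ^ 'm::finite"
  shows "(l1, l2) \<in> feasibility_region U b V d p1 q1 p2 q2 \<longleftrightarrow>
    (\<exists>y. \<forall>r c. A_mat U b p1 q1 p2 q2 $ r $ c + ereal (y $ c) \<le> mp_mult (B_mat V d l1 l2) (ereal_vec y) $ r)"
    (is "?L \<longleftrightarrow> ?R")
proof
  assume ?L
  then obtain x :: "real ^ 'n" where x: "feasible U b V d x"
    "objective p1 q1 x \<le> ereal l1" "objective p2 q2 x \<le> ereal l2"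
    by (auto simp: feasibility_region_def)
  define y :: "real ^ 'n col" where "y = (\<chi> c. case c of Col j \<Rightarrow> x $ j | Last \<Rightarrow> 0)"
  have "y $ Last = 0" "(\<chi> j. y $ Col j) = x"
    by (simp_all add: y_def vec_eq_iff)
  with x A_le_B_iff_feasible[of y U b p1 q1 p2 q2 V d l1 l2] show ?R by auto
next
  assume ?R
  then obtain y where y: "\<And>r c. A_mat U b p1 q1 p2 q2 $ r $ c + ereal (y $ c)
      \<le> mp_mult (B_mat V d l1 l2) (ereal_vec y) $ r" by blast
  define z where "z = (\<chi> c. y $ c - y $ Last)"
  have shift: "a + ereal (z $ c) = a + ereal (y $ c) + ereal (- y $ Last)" for a c
    by (cases a) (simp_all add: z_def)
  have "mp_mult (B_mat V d l1 l2) (ereal_vec z) $ r =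
      mp_mult (B_mat V d l1 l2) (ereal_vec y) $ r + ereal (- y $ Last)" for r
    unfolding mp_mult_def ereal_vec_def vec_lambda_beta shift by (rule ereal_Max_add_right) auto
  then have "\<forall>r c. A_mat U b p1 q1 p2 q2 $ r $ c + ereal (z $ c)
      \<le> mp_mult (B_mat V d l1 l2) (ereal_vec z) $ r"
    unfolding shift using y by (simp add: add_right_mono)
  moreover have "z $ Last = 0" by (simp add: z_def)
  ultimately show ?L
    using A_le_B_iff_feasible[of z U b p1 q1 p2 q2 V d l1 l2] by (auto simp: feasibility_region_def)
qed

lemma mp_game_blocks:
  fixes U V :: "ereal ^ 'n::finite ^ 'm::finite" and b d :: "ereal ^ 'm" and p1 p2 q1 q2 :: "ereal ^ 'n"
  assumes "\<And>i j. U $ i $ j \<noteq> \<infinity>" "\<And>i j. V $ i $ j \<noteq> \<infinity>" "\<And>i. b $ i \<noteq> \<infinity>" "\<And>i. d $ i \<noteq> \<infinity>"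
    and "\<And>j. p1 $ j \<noteq> \<infinity>" "\<And>j. p2 $ j \<noteq> \<infinity>" "\<And>j. q1 $ j \<noteq> -\<infinity>" "\<And>j. q2 $ j \<noteq> -\<infinity>"
    and V: "\<And>i. \<exists>j. \<bar>V $ i $ j\<bar> \<noteq> \<infinity>"
    and "\<And>c. \<exists>r. A_mat U b p1 q1 p2 q2 $ r $ c \<noteq> -\<infinity>"
  shows "mp_game (A_mat U b p1 q1 p2 q2) (B_mat V d l1 l2)"
proof
  have neg: "- q = \<infinity> \<longleftrightarrow> q = -\<infinity>" for q :: ereal
    by (cases q) auto
  fix r :: "('m, 'n) row" and c :: "'n col"
  show "A_mat U b p1 q1 p2 q2 $ r $ c \<noteq> \<infinity>"
    using assms by (cases r; cases c) (auto simp: A_mat_def neg)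
  show "B_mat V d l1 l2 $ r $ c \<noteq> \<infinity>"
    using assms by (cases r; cases c) (auto simp: B_mat_def)
  show "\<exists>r. A_mat U b p1 q1 p2 q2 $ r $ c \<noteq> -\<infinity>" by fact
  show "\<exists>c. B_mat V d l1 l2 $ r $ c \<noteq> -\<infinity>"
  proof (cases r)
    case (C1 i)
    from V[of i] obtain j where "\<bar>V $ i $ j\<bar> \<noteq> \<infinity>" by (rule exE) (rule that)
    then have "B_mat V d l1 l2 $ r $ Col j \<noteq> -\<infinity>" by (auto simp: B_mat_def C1)
    then show ?thesis by blast
  next
    case (C2 j)
    then have "B_mat V d l1 l2 $ r $ Col j \<noteq> -\<infinity>" by (simp add: B_mat_def)
    then show ?thesis by blast
  next
    case C3
    then have "B_mat V d l1 l2 $ r $ Last \<noteq> -\<infinity>" by (simp add: B_mat_def)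
    then show ?thesis by blast
  next
    case (C4 j)
    then have "B_mat V d l1 l2 $ r $ Col j \<noteq> -\<infinity>" by (simp add: B_mat_def)
    then show ?thesis by blast
  next
    case C5
    then have "B_mat V d l1 l2 $ r $ Last \<noteq> -\<infinity>" by (simp add: B_mat_def)
    then show ?thesis by blast
  qed
qed

section \<open>Cycle means as functions of the two parameters\<close>

lemma B_mat_MInf_iff: "B_mat V d l1 l2 $ r $ c = -\<infinity> \<longleftrightarrow> B_mat V d \<mu>1 \<mu>2 $ r $ c = -\<infinity>"
  by (cases r) (simp_all add: B_mat_def)

text \<open>Real parameters never change which entries are \<open>-\<infinity>\<close>, so one
  \<open>\<sigma>\<close> can be followed over the whole parameter plane.\<close>

lemma max_strategies_B_mat: "max_strategies (B_mat V d l1 l2) = max_strategies (B_mat V d \<mu>1 \<mu>2)"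
  unfolding max_strategies_def using B_mat_MInf_iff by blast

lemma rest_weight_finite:
  fixes V :: "ereal ^ 'n::finite ^ 'm::finite"
  assumes "mp_game A (B_mat V d l1 l2)" "\<sigma> \<in> max_strategies (B_mat V d l1 l2)"
    and e: "e \<in> arcs (one_player_game A \<sigma>)"
  shows "\<bar>rest_weight A V d e\<bar> \<noteq> \<infinity>"
  using e
proof (cases rule: one_player_game_arc_cases)
  case (Min j i)
  then show ?thesis
    using mp_game.A_not_PInf[OF assms(1), of i j] by (cases "A $ i $ j") auto
next
  case (Max i)
  have "B_mat V d l1 l2 $ i $ \<sigma> i \<noteq> \<infinity>" "B_mat V d l1 l2 $ i $ \<sigma> i \<noteq> -\<infinity>"
    using mp_game.B_not_PInf[OF assms(1)] assms(2) by (auto simp: max_strategies_def)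
  then show ?thesis
    unfolding Max by (cases i) (auto simp: B_mat_def)
qed

lemma arc_weight_decomposition:
  fixes V :: "ereal ^ 'n::finite ^ 'm::finite"
  assumes "\<sigma> \<in> max_strategies (B_mat V d l1 l2)" and e: "e \<in> arcs (one_player_game A \<sigma>)"
  shows "arc_weight A (B_mat V d l1 l2) e =
    (if fst e \<in> Max_node ` (range C2 \<union> {C3}) then l1 else 0) +
    (if fst e \<in> Max_node ` (range C4 \<union> {C5}) then l2 else 0) + real_of_ereal (rest_weight A V d e)"
  using e
proof (cases rule: one_player_game_arc_cases)
  case (Max i)
  have "B_mat V d l1 l2 $ i $ \<sigma> i \<noteq> -\<infinity>"
    using assms(1) by (auto simp: max_strategies_def)
  then show ?thesis
    unfolding Max by (cases i) (auto simp: B_mat_def split: if_splits)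
qed auto

lemma sum_arc_weight:
  fixes V :: "ereal ^ 'n::finite ^ 'm::finite"
  assumes game: "mp_game A (B_mat V d l1 l2)" and \<sigma>: "\<sigma> \<in> max_strategies (B_mat V d l1 l2)"
    and "set \<gamma> \<subseteq> arcs (one_player_game A \<sigma>)"
  shows "(\<Sum>e\<leftarrow>\<gamma>. arc_weight A (B_mat V d l1 l2) e) =
    real (k1 \<gamma>) * l1 + real (k2 \<gamma>) * l2 + rest_sum A V d \<gamma>"
proof -
  \<comment> \<open>Finiteness of the sum is carried through the induction because
    \<open>real_of_ereal\<close> is additive on finite values but not in general.\<close>
  have "\<bar>\<Sum>e\<leftarrow>\<gamma>. rest_weight A V d e\<bar> \<noteq> \<infinity> \<and> ?thesis"
    using assms(3)
  proof (induction \<gamma>)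
    case (Cons e \<gamma>)
    then have e: "e \<in> arcs (one_player_game A \<sigma>)" and IH: "\<bar>\<Sum>e\<leftarrow>\<gamma>. rest_weight A V d e\<bar> \<noteq> \<infinity>"
      "(\<Sum>e\<leftarrow>\<gamma>. arc_weight A (B_mat V d l1 l2) e) =
        real (k1 \<gamma>) * l1 + real (k2 \<gamma>) * l2 + rest_sum A V d \<gamma>"
      by auto
    note finite = rest_weight_finite[OF game \<sigma> e]
    have "\<bar>\<Sum>e\<leftarrow>e # \<gamma>. rest_weight A V d e\<bar> \<noteq> \<infinity>"
      using finite IH(1) by (cases "rest_weight A V d e"; cases "\<Sum>e\<leftarrow>\<gamma>. rest_weight A V d e") auto
    moreover have "rest_sum A V d (e # \<gamma>) = real_of_ereal (rest_weight A V d e) + rest_sum A V d \<gamma>"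
      using finite IH(1) by (simp add: rest_sum_def real_of_ereal_add)
    ultimately show ?case
      by (simp add: IH(2) arc_weight_decomposition[OF \<sigma> e] k1_def k2_def algebra_simps)
  qed (simp add: k1_def k2_def rest_sum_def)
  then show ?thesis by blast
qed

lemma cycle_mean_affine:
  "cycle_mean A V d \<mu>1 \<mu>2 \<gamma> = real (k1 \<gamma>) / (real (length \<gamma>) / 2) * \<mu>1 +
    real (k2 \<gamma>) / (real (length \<gamma>) / 2) * \<mu>2 + rest_sum A V d \<gamma> / (real (length \<gamma>) / 2)"
  by (simp only: cycle_mean_def add_divide_distrib times_divide_eq_left)

text \<open>Every accessible closed walk has a mean no smaller than the cycle time, and some
  elementary cycle attains it; so the minimum over the finitely many elementary cycles is also the
  minimum over all closed walks.\<close>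

lemma cycle_time_fun_max_strat:
  fixes V :: "ereal ^ 'n::finite ^ 'm::finite"
  assumes game: "mp_game A (B_mat V d l1 l2)" and \<sigma>: "\<sigma> \<in> max_strategies (B_mat V d l1 l2)"
  shows "\<gamma> \<in> closed_walks (one_player_game A \<sigma>) (Min_node j) \<Longrightarrow>
      cycle_time (fun_max_strat A (B_mat V d l1 l2) \<sigma>) $ j \<le> cycle_mean A V d l1 l2 \<gamma>"
    and "cycle_time (fun_max_strat A (B_mat V d l1 l2) \<sigma>) $ j =
      (MIN \<gamma>\<in>elementary_cycles (one_player_game A \<sigma>) (Min_node j). cycle_mean A V d l1 l2 \<gamma>)"
proof -
  interpret mp_game A "B_mat V d l1 l2" by fact
  interpret wf_digraph "one_player_game A \<sigma>" by (rule wf_one_player_game)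
  have mean: "(\<Sum>e\<leftarrow>\<gamma>. arc_weight A (B_mat V d l1 l2) e) / (real (length \<gamma>) / 2) = cycle_mean A V d l1 l2 \<gamma>"
    if "\<gamma> \<in> closed_walks (one_player_game A \<sigma>) (Min_node j)" for \<gamma>
  proof -
    have "set \<gamma> \<subseteq> arcs (one_player_game A \<sigma>)"
      using that by (auto simp: closed_walks_def closed_w_def awalk_def)
    then show ?thesis
      unfolding cycle_mean_def by (simp add: sum_arc_weight[OF game \<sigma>])
  qed
  show le: "cycle_time (fun_max_strat A (B_mat V d l1 l2) \<sigma>) $ j \<le> cycle_mean A V d l1 l2 \<gamma>"
    if "\<gamma> \<in> closed_walks (one_player_game A \<sigma>) (Min_node j)" for \<gamma>
    using cycle_time_closed_walk_and_cycle(1)[OF \<sigma> that] unfolding mean[OF that] .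
  obtain \<gamma> where \<gamma>: "\<gamma> \<in> elementary_cycles (one_player_game A \<sigma>) (Min_node j)"
    and eq: "cycle_time (fun_max_strat A (B_mat V d l1 l2) \<sigma>) $ j =
      (\<Sum>e\<leftarrow>\<gamma>. arc_weight A (B_mat V d l1 l2) e) / (real (length \<gamma>) / 2)"
    using cycle_time_closed_walk_and_cycle(2)[OF \<sigma>] by blast
  note closed = subsetD[OF elementary_cycles_subset_closed_walks]
  show "cycle_time (fun_max_strat A (B_mat V d l1 l2) \<sigma>) $ j =
      (MIN \<gamma>\<in>elementary_cycles (one_player_game A \<sigma>) (Min_node j). cycle_mean A V d l1 l2 \<gamma>)"
  proof (rule Min_eqI[symmetric])
    show "cycle_time (fun_max_strat A (B_mat V d l1 l2) \<sigma>) $ j \<in>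
        cycle_mean A V d l1 l2 ` elementary_cycles (one_player_game A \<sigma>) (Min_node j)"
      using \<gamma> eq mean[OF closed[OF \<gamma>]] by (intro image_eqI[of _ _ \<gamma>]) simp_all
  qed (auto simp: finite_elementary_cycles intro: le closed)
qed

text \<open>Each cycle mean is an inner product with a fixed vector plus a constant. The entries of
  that vector come from counting arcs, hence are nonnegative, which gives monotonicity.\<close>

lemma piecewise_linear_Min_cycle_mean:
  fixes \<Gamma> :: "(('m::finite, 'n::finite) row, 'n col) arc list set"
  assumes "finite \<Gamma>" "\<Gamma> \<noteq> {}"
  shows "piecewise_linear (\<lambda>(\<mu>1, \<mu>2). MIN \<gamma>\<in>\<Gamma>. cycle_mean A V d \<mu>1 \<mu>2 \<gamma>)"
    and "continuous_on UNIV (\<lambda>(\<mu>1, \<mu>2). MIN \<gamma>\<in>\<Gamma>. cycle_mean A V d \<mu>1 \<mu>2 \<gamma>)"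
    and "\<mu>1 \<le> \<nu>1 \<Longrightarrow> \<mu>2 \<le> \<nu>2 \<Longrightarrow>
      (MIN \<gamma>\<in>\<Gamma>. cycle_mean A V d \<mu>1 \<mu>2 \<gamma>) \<le> (MIN \<gamma>\<in>\<Gamma>. cycle_mean A V d \<nu>1 \<nu>2 \<gamma>)"
proof -
  let ?a = "\<lambda>\<gamma>. (real (k1 \<gamma>) / (real (length \<gamma>) / 2), real (k2 \<gamma>) / (real (length \<gamma>) / 2))"
  have eq: "(\<lambda>(\<mu>1, \<mu>2). MIN \<gamma>\<in>\<Gamma>. cycle_mean A V d \<mu>1 \<mu>2 \<gamma>) =
      (\<lambda>x. MIN \<gamma>\<in>\<Gamma>. ?a \<gamma> \<bullet> x + rest_sum A V d \<gamma> / (real (length \<gamma>) / 2))"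
    unfolding cycle_mean_affine by (auto simp: fun_eq_iff)
  show "piecewise_linear (\<lambda>(\<mu>1, \<mu>2). MIN \<gamma>\<in>\<Gamma>. cycle_mean A V d \<mu>1 \<mu>2 \<gamma>)"
    unfolding eq using assms by (rule piecewise_linear_Min_affine)
  show "continuous_on UNIV (\<lambda>(\<mu>1, \<mu>2). MIN \<gamma>\<in>\<Gamma>. cycle_mean A V d \<mu>1 \<mu>2 \<gamma>)"
    unfolding eq using assms by (intro continuous_on_Min_image continuous_intros)
  show "(MIN \<gamma>\<in>\<Gamma>. cycle_mean A V d \<mu>1 \<mu>2 \<gamma>) \<le> (MIN \<gamma>\<in>\<Gamma>. cycle_mean A V d \<nu>1 \<nu>2 \<gamma>)"
    if "\<mu>1 \<le> \<nu>1" "\<mu>2 \<le> \<nu>2"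
    using assms unfolding cycle_mean_affine
    by (intro mono_Min_image add_mono mult_left_mono that) simp_all
qed

theorem proposition4p7:
  fixes U V :: "ereal ^ 'n::finite ^ 'm::finite"
    and b d :: "ereal ^ 'm"
    and p1 p2 q1 q2 :: "ereal ^ 'n"
    and A :: "ereal ^ 'n col ^ ('m, 'n) row"
    and B :: "real \<Rightarrow> real \<Rightarrow> ereal ^ 'n col ^ ('m, 'n) row"
    and l1 l2 :: real
  assumes "\<And>i j. U $ i $ j \<noteq> \<infinity>" and "\<And>i j. V $ i $ j \<noteq> \<infinity>"
    and "\<And>i. b $ i \<noteq> \<infinity>" and "\<And>i. d $ i \<noteq> \<infinity>"
    and "\<And>j. p1 $ j \<noteq> \<infinity>" and "\<And>j. p2 $ j \<noteq> \<infinity>"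
    and "\<And>j. q1 $ j \<noteq> -\<infinity>" and "\<And>j. q2 $ j \<noteq> -\<infinity>"
    and "\<And>i. \<exists>j. \<bar>U $ i $ j\<bar> \<noteq> \<infinity>" and "\<And>i. \<exists>j. \<bar>V $ i $ j\<bar> \<noteq> \<infinity>"
    and "\<exists>j. \<bar>p1 $ j\<bar> \<noteq> \<infinity>" and "\<exists>j. \<bar>p2 $ j\<bar> \<noteq> \<infinity>"
    and "\<exists>j. \<bar>q1 $ j\<bar> \<noteq> \<infinity>" and "\<exists>j. \<bar>q2 $ j\<bar> \<noteq> \<infinity>"
    and A_eq: "A = A_mat U b p1 q1 p2 q2"
    and B_eq: "B = B_mat V d"
    \<comment> \<open>Min has a move at every node, so that the game is well defined\<close>
    and Min_can_move: "\<And>j. \<exists>i. A $ i $ j \<noteq> -\<infinity>"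
  shows
    "\<comment> \<open>(i)\<close>
    has_cycle_time (minmax_fun A (B l1 l2)) (cycle_time (minmax_fun A (B l1 l2))) \<and>
     (\<forall>v. is_game_value A (B l1 l2) v \<longleftrightarrow> v = cycle_time (minmax_fun A (B l1 l2))) \<and>
     (\<exists>\<sigma>\<in>max_strategies (B l1 l2). \<exists>\<tau>\<in>min_strategies A. \<forall>j.
        max_secures A (B l1 l2) (positional_max \<sigma>) j
          (cycle_time (minmax_fun A (B l1 l2)) $ j) \<and>
        min_secures A (B l1 l2) (positional_min \<tau>) j
          (cycle_time (minmax_fun A (B l1 l2)) $ j)) \<and>
    \<comment> \<open>(ii)\<close>
    (\<forall>\<sigma>\<in>max_strategies (B l1 l2). has_cycle_time (fun_max_strat A (B l1 l2) \<sigma>)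
        (cycle_time (fun_max_strat A (B l1 l2) \<sigma>))) \<and>
     (\<forall>\<tau>\<in>min_strategies A. has_cycle_time (fun_min_strat A (B l1 l2) \<tau>)
        (cycle_time (fun_min_strat A (B l1 l2) \<tau>))) \<and>
     (\<forall>j. (MAX \<sigma>\<in>max_strategies (B l1 l2). cycle_time (fun_max_strat A (B l1 l2) \<sigma>) $ j) =
             cycle_time (minmax_fun A (B l1 l2)) $ j \<and>
           cycle_time (minmax_fun A (B l1 l2)) $ j =
             (MIN \<tau>\<in>min_strategies A. cycle_time (fun_min_strat A (B l1 l2) \<tau>) $ j)) \<and>
    \<comment> \<open>(iii)\<close>
    (\<forall>\<sigma>\<in>max_strategies (B l1 l2).
       (\<forall>i. out_degree (one_player_game A \<sigma>) (Max_node i) = 1) \<and>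
       (\<forall>v. elementary_cycles (one_player_game A \<sigma>) v \<noteq> {} \<and>
            finite (elementary_cycles (one_player_game A \<sigma>) v)) \<and>
       (\<forall>j. \<forall>\<gamma>\<in>elementary_cycles (one_player_game A \<sigma>) (Min_node j).
          \<exists>\<alpha>\<ge>0. \<exists>\<beta>\<ge>0. \<exists>c. \<forall>\<mu>1 \<mu>2. cycle_mean A V d \<mu>1 \<mu>2 \<gamma> = \<alpha> * \<mu>1 + \<beta> * \<mu>2 + c) \<and>
       (\<forall>j \<mu>1 \<mu>2.
          cycle_time (fun_max_strat A (B \<mu>1 \<mu>2) \<sigma>) $ j =
            (MIN \<gamma>\<in>elementary_cycles (one_player_game A \<sigma>) (Min_node j).
               cycle_mean A V d \<mu>1 \<mu>2 \<gamma>) \<and>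
          (\<forall>\<gamma>\<in>closed_walks (one_player_game A \<sigma>) (Min_node j).
             cycle_time (fun_max_strat A (B \<mu>1 \<mu>2) \<sigma>) $ j \<le> cycle_mean A V d \<mu>1 \<mu>2 \<gamma>)) \<and>
       (\<forall>j. piecewise_linear (\<lambda>(\<mu>1, \<mu>2). cycle_time (fun_max_strat A (B \<mu>1 \<mu>2) \<sigma>) $ j) \<and>
            continuous_on UNIV (\<lambda>(\<mu>1, \<mu>2). cycle_time (fun_max_strat A (B \<mu>1 \<mu>2) \<sigma>) $ j) \<and>
            (\<forall>\<mu>1 \<mu>2 \<nu>1 \<nu>2. \<mu>1 \<le> \<nu>1 \<and> \<mu>2 \<le> \<nu>2 \<longrightarrow>
               cycle_time (fun_max_strat A (B \<mu>1 \<mu>2) \<sigma>) $ j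
                 \<le> cycle_time (fun_max_strat A (B \<nu>1 \<nu>2) \<sigma>) $ j))) \<and>
    \<comment> \<open>(iv)\<close>
    ((l1, l2) \<in> feasibility_region U b V d p1 q1 p2 q2 \<longleftrightarrow>
       (\<forall>j. cycle_time (minmax_fun A (B l1 l2)) $ j \<ge> 0))"
proof -
  have game: "mp_game A (B \<mu>1 \<mu>2)" for \<mu>1 \<mu>2
    unfolding A_eq B_eq using assms by (intro mp_game_blocks) simp_all
  have strategies: "max_strategies (B l1 l2) = max_strategies (B \<mu>1 \<mu>2)" for \<mu>1 \<mu>2
    unfolding B_eq by (rule max_strategies_B_mat)
  interpret mp_game A "B l1 l2" by (rule game)
  have iii: "(\<forall>i. out_degree (one_player_game A \<sigma>) (Max_node i) = 1) \<and>
       (\<forall>v. elementary_cycles (one_player_game A \<sigma>) v \<noteq> {} \<and>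
            finite (elementary_cycles (one_player_game A \<sigma>) v)) \<and>
       (\<forall>j. \<forall>\<gamma>\<in>elementary_cycles (one_player_game A \<sigma>) (Min_node j).
          \<exists>\<alpha>\<ge>0. \<exists>\<beta>\<ge>0. \<exists>c. \<forall>\<mu>1 \<mu>2. cycle_mean A V d \<mu>1 \<mu>2 \<gamma> = \<alpha> * \<mu>1 + \<beta> * \<mu>2 + c) \<and>
       (\<forall>j \<mu>1 \<mu>2.
          cycle_time (fun_max_strat A (B \<mu>1 \<mu>2) \<sigma>) $ j =
            (MIN \<gamma>\<in>elementary_cycles (one_player_game A \<sigma>) (Min_node j).
               cycle_mean A V d \<mu>1 \<mu>2 \<gamma>) \<and>
          (\<forall>\<gamma>\<in>closed_walks (one_player_game A \<sigma>) (Min_node j).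
             cycle_time (fun_max_strat A (B \<mu>1 \<mu>2) \<sigma>) $ j \<le> cycle_mean A V d \<mu>1 \<mu>2 \<gamma>)) \<and>
       (\<forall>j. piecewise_linear (\<lambda>(\<mu>1, \<mu>2). cycle_time (fun_max_strat A (B \<mu>1 \<mu>2) \<sigma>) $ j) \<and>
            continuous_on UNIV (\<lambda>(\<mu>1, \<mu>2). cycle_time (fun_max_strat A (B \<mu>1 \<mu>2) \<sigma>) $ j) \<and>
            (\<forall>\<mu>1 \<mu>2 \<nu>1 \<nu>2. \<mu>1 \<le> \<nu>1 \<and> \<mu>2 \<le> \<nu>2 \<longrightarrow>
               cycle_time (fun_max_strat A (B \<mu>1 \<mu>2) \<sigma>) $ j
                 \<le> cycle_time (fun_max_strat A (B \<nu>1 \<nu>2) \<sigma>) $ j))"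
    if \<sigma>: "\<sigma> \<in> max_strategies (B l1 l2)" for \<sigma>
  proof -
    \<comment> \<open>\<open>\<sigma>\<close> remains a strategy for all parameters and its digraph
      does not involve them, so one fixed set of cycles serves the whole plane.\<close>
    have \<sigma>': "\<sigma> \<in> max_strategies (B_mat V d \<mu>1 \<mu>2)" for \<mu>1 \<mu>2
      using \<sigma> strategies[of \<mu>1 \<mu>2] by (simp add: B_eq)
    note cycle_time = cycle_time_fun_max_strat[OF game[unfolded B_eq] \<sigma>', folded B_eq]
    note Min = piecewise_linear_Min_cycle_mean[OF finite_elementary_cycles elementary_cycles_nonempty]
    have affine: "\<exists>\<alpha>\<ge>0. \<exists>\<beta>\<ge>0. \<exists>c. \<forall>\<mu>1 \<mu>2. cycle_mean A V d \<mu>1 \<mu>2 \<gamma> = \<alpha> * \<mu>1 + \<beta> * \<mu>2 + c" for \<gamma>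
      by (rule exI[of _ "real (k1 \<gamma>) / (real (length \<gamma>) / 2)"], rule conjI, simp,
          rule exI[of _ "real (k2 \<gamma>) / (real (length \<gamma>) / 2)"], rule conjI, simp,
          rule exI, intro allI, rule cycle_mean_affine)
    have pl: "piecewise_linear (\<lambda>(\<mu>1, \<mu>2). cycle_time (fun_max_strat A (B \<mu>1 \<mu>2) \<sigma>) $ j)" for j
      unfolding cycle_time(2) by (rule Min(1))
    have cont: "continuous_on UNIV (\<lambda>(\<mu>1, \<mu>2). cycle_time (fun_max_strat A (B \<mu>1 \<mu>2) \<sigma>) $ j)" for j
      unfolding cycle_time(2) by (rule Min(2))
    have mono: "cycle_time (fun_max_strat A (B \<mu>1 \<mu>2) \<sigma>) $ j \<le> cycle_time (fun_max_strat A (B \<nu>1 \<nu>2) \<sigma>) $ j"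
      if "\<mu>1 \<le> \<nu>1 \<and> \<mu>2 \<le> \<nu>2" for j \<mu>1 \<mu>2 \<nu>1 \<nu>2
      unfolding cycle_time(2) using that by (intro Min(3)) simp_all
    show ?thesis
      by (intro conjI allI ballI impI out_degree_Max_node elementary_cycles_nonempty
          finite_elementary_cycles affine pl cont) (fact cycle_time | rule cycle_time(1) mono, assumption)+
  qed
  \<comment> \<open>Both sides amount to the existence of a finite y with A \<otimes> y \<le> B
    \<otimes> y.\<close>
  have iv: "(l1, l2) \<in> feasibility_region U b V d p1 q1 p2 q2 \<longleftrightarrow>
       (\<forall>j. cycle_time (minmax_fun A (B l1 l2)) $ j \<ge> 0)"
    unfolding cycle_time_nonneg_iff unfolding feasibility_region_iff A_eq B_eq by (rule refl)
  have game_val: "\<forall>v. is_game_value A (B l1 l2) v \<longleftrightarrow> v = cycle_time (minmax_fun A (B l1 l2))"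
    by (rule allI) (rule game_value(2))
  have max_strats: "\<forall>\<sigma>\<in>max_strategies (B l1 l2). has_cycle_time (fun_max_strat A (B l1 l2) \<sigma>)
      (cycle_time (fun_max_strat A (B l1 l2) \<sigma>))"
    by (rule ballI) (rule has_cycle_time_fun_max_strat)
  have min_strats: "\<forall>\<tau>\<in>min_strategies A. has_cycle_time (fun_min_strat A (B l1 l2) \<tau>)
      (cycle_time (fun_min_strat A (B l1 l2) \<tau>))"
    by (rule ballI) (rule has_cycle_time_fun_min_strat)
  have dual: "\<forall>j. (MAX \<sigma>\<in>max_strategies (B l1 l2). cycle_time (fun_max_strat A (B l1 l2) \<sigma>) $ j) =
        cycle_time (minmax_fun A (B l1 l2)) $ j \<and>
      cycle_time (minmax_fun A (B l1 l2)) $ j =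
        (MIN \<tau>\<in>min_strategies A. cycle_time (fun_min_strat A (B l1 l2) \<tau>) $ j)"
    by (rule allI) (rule conjI[OF duality(1) duality(2)[symmetric]])
  show ?thesis
    by (rule conjI[OF game_value(1) conjI[OF game_val conjI[OF game_value(3)
          conjI[OF max_strats conjI[OF min_strats conjI[OF dual conjI[OF _ iv]]]]]]])
      (rule ballI, rule iii)
qed

end
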